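(* Let $a,b,c$ be positive integers with $ac<b^2$ and with $b$ divisible by both $a$ and $c$. Then for generic $x,y\in\mathbb{C}^*$, \[ f_{a,b,c}(x,y,q)=h_{a,b,c}(x,y,q,-1,-1)-\frac{1}{\overline{J}_{0,b^2/a-c}\,\overline{J}_{0,b^2/c-a}}\,\theta_{a,b,c}(x,y,q), \] where \[ h_{a,b,c}(x,y,q,z_1,z_0):=j(x;q^a)\,m\Big(-q^{a\binom{b/a+1}{2}-c}(-y)(-x)^{-b/a},q^{b^2/a-c},z_1\Big)+j(y;q^c)\,m\Big(-q^{c\binom{b/c+1}{2}-a}(-x)(-y)^{-b/c},q^{b^2/c-a},z_0\Big), \] and \begin{align*} \theta_{a,b,c}(x,y,q):=&\sum_{d=0}^{b/c-1}\sum_{e=0}^{b/a-1}\sum_{f=0}^{b/a-1}q^{(b^2/a-c)\binom{d+1}{2}+(b^2/c-a)\binom{e+f+1}{2}+a\binom f2}\,j\big(q^{(b^2/a-c)(d+1)+bf}y;q^{b^2/a}\big)(-x)^f\\ &\cdot j\big(q^{b(b^2/(ac)-1)(e+f+1)-(b^2/a-c)(d+1)+b^3(b-a)/(2a^2c)}(-x)^{b/a}y^{-1};q^{(b^2/a)(b^2/(ac)-1)}\big)\\ &\cdot\frac{J_{b(b^2/(ac)-1)}^3\,j\big(q^{(b^2/c-a)(e+1)+(b^2/a-c)(d+1)-c\binom{b/c}{2}-a\binom{b/a}{2}}(-x)^{1-b/a}(-y)^{1-b/c};q^{b(b^2/(ac)-1)}\big)}{j\big(q^{(b^2/c-a)(e+1)-c\binom{b/c}{2}}(-x)(-y)^{-b/c};q^{b(b^2/(ac)-1)}\big)\,j\big(q^{(b^2/a-c)(d+1)-a\binom{b/a}{2}}(-x)^{-b/a}(-y);q^{b(b^2/(ac)-1)}\big)}.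 \end{align*}
   Context: Let $q\in\mathbb{C}$ with $0<|q|<1$. Notation: $j(x;q):=(x;q)_\infty(q/x;q)_\infty(q;q)_\infty=\sum_{n\in\mathbb{Z}}(-1)^nq^{\binom n2}x^n$, where $(x;q)_\infty=\prod_{i\ge0}(1-q^ix)$; for integers $a$ and $m>0$, $J_{a,m}:=j(q^a;q^m)$, $\overline{J}_{a,m}:=j(-q^a;q^m)$, $J_m:=J_{m,3m}=\prod_{i\ge1}(1-q^{mi})$. The Appell–Lerch sum is $m(x,q,z):=\frac{1}{j(z;q)}\sum_{r\in\mathbb{Z}}\frac{(-1)^rq^{\binom r2}z^r}{1-q^{r-1}xz}$ (neither $z$ nor $xz$ an integral power of $q$). With $\mathrm{sg}(r)=1$ for $r\ge0$ and $-1$ for $r<0$, $f_{a,b,c}(x,y,q):=\sum_{\mathrm{sg}(r)=\mathrm{sg}(s)}\mathrm{sg}(r)(-1)^{r+s}x^ry^sq^{a\binom r2+brs+c\binom s2}$. "Generic" means $x,y,q$ cause no poles in the Appell–Lerch sums or theta quotients. *)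

theory Defs
  imports "HOL-Analysis.Analysis"
begin

definition choose2 :: "int \<Rightarrow> int" where
  "choose2 n = n * (n - 1) div 2"

definition qpoch_inf :: "complex \<Rightarrow> complex \<Rightarrow> complex" where
  "qpoch_inf x q = (\<Prod>i. 1 - q ^ i * x)"

definition jtheta :: "complex \<Rightarrow> complex \<Rightarrow> complex" where
  "jtheta x q = qpoch_inf x q * qpoch_inf (q / x) q * qpoch_inf q q"

definition J2 :: "int \<Rightarrow> int \<Rightarrow> complex \<Rightarrow> complex" where
  "J2 a m q = jtheta (q powi a) (q powi m)"

definition J2_bar :: "int \<Rightarrow> int \<Rightarrow> complex \<Rightarrow> complex" where
  "J2_bar a m q = jtheta (- (q powi a)) (q powi m)"

definition J1 :: "int \<Rightarrow> complex \<Rightarrow> complex" where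
  "J1 m q = J2 m (3 * m) q"

definition appell_lerch :: "complex \<Rightarrow> complex \<Rightarrow> complex \<Rightarrow> complex" where
  "appell_lerch x q z =
     1 / jtheta z q *
     (\<Sum>\<^sub>\<infinity>r::int. (-1) powi r * q powi (choose2 r) * z powi r / (1 - q powi (r - 1) * x * z))"

definition appell_lerch_no_pole :: "complex \<Rightarrow> complex \<Rightarrow> complex \<Rightarrow> bool" where
  "appell_lerch_no_pole x q z \<longleftrightarrow> (\<forall>k::int. z \<noteq> q powi k) \<and> (\<forall>k::int. x * z \<noteq> q powi k)"

text \<open>Unlike \<^const>\<open>sgn\<close>, this takes the value 1 at 0.\<close>

definition sg :: "int \<Rightarrow> int" where
  "sg r = (if r \<ge> 0 then 1 else -1)"

definition hecke_f :: "int \<Rightarrow> int \<Rightarrow> int \<Rightarrow> complex \<Rightarrow> complex \<Rightarrow> complex \<Rightarrow> complex" where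
  "hecke_f a b c x y q =
     (\<Sum>\<^sub>\<infinity>(r, s)\<in>{(r, s). sg r = sg s}.
        of_int (sg r) * (-1) powi (r + s) * x powi r * y powi s *
        q powi (a * choose2 r + b * r * s + c * choose2 s))"

text \<open>
  Below, \<open>b\<close> is divisible by \<open>a\<close> and by \<open>c\<close>. All the integer divisions that occur are then exact;
  in particular \<open>b\<^sup>3 (b - a) / (2 a\<^sup>2 c)\<close> is \<open>(b\<^sup>2 / (a c)) \<cdot> a (b/a choose 2)\<close>.
\<close>

definition al_arg1 :: "int \<Rightarrow> int \<Rightarrow> int \<Rightarrow> complex \<Rightarrow> complex \<Rightarrow> complex \<Rightarrow> complex" where
  "al_arg1 a b c x y q =
     - (q powi (a * choose2 (b div a + 1) - c)) * (- y) * (- x) powi (- (b div a))"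

definition al_arg0 :: "int \<Rightarrow> int \<Rightarrow> int \<Rightarrow> complex \<Rightarrow> complex \<Rightarrow> complex \<Rightarrow> complex" where
  "al_arg0 a b c x y q =
     - (q powi (c * choose2 (b div c + 1) - a)) * (- x) * (- y) powi (- (b div c))"

definition h_abc ::
  "int \<Rightarrow> int \<Rightarrow> int \<Rightarrow> complex \<Rightarrow> complex \<Rightarrow> complex \<Rightarrow> complex \<Rightarrow> complex \<Rightarrow> complex" where
  "h_abc a b c x y q z1 z0 =
     jtheta x (q powi a) * appell_lerch (al_arg1 a b c x y q) (q powi (b^2 div a - c)) z1 +
     jtheta y (q powi c) * appell_lerch (al_arg0 a b c x y q) (q powi (b^2 div c - a)) z0"

definition theta_denom_e ::
  "int \<Rightarrow> int \<Rightarrow> int \<Rightarrow> complex \<Rightarrow> complex \<Rightarrow> complex \<Rightarrow> int \<Rightarrow> complex" where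
  "theta_denom_e a b c x y q e =
     jtheta (q powi ((b^2 div c - a) * (e + 1) - c * choose2 (b div c))
               * (- x) * (- y) powi (- (b div c)))
            (q powi (b * (b^2 div (a * c) - 1)))"

definition theta_denom_d ::
  "int \<Rightarrow> int \<Rightarrow> int \<Rightarrow> complex \<Rightarrow> complex \<Rightarrow> complex \<Rightarrow> int \<Rightarrow> complex" where
  "theta_denom_d a b c x y q d =
     jtheta (q powi ((b^2 div a - c) * (d + 1) - a * choose2 (b div a))
               * (- x) powi (- (b div a)) * (- y))
            (q powi (b * (b^2 div (a * c) - 1)))"

definition theta_abc :: "int \<Rightarrow> int \<Rightarrow> int \<Rightarrow> complex \<Rightarrow> complex \<Rightarrow> complex \<Rightarrow> complex" where
  "theta_abc a b c x y q =
     (\<Sum>d = 0..b div c - 1. \<Sum>e = 0..b div a - 1. \<Sum>f = 0..b div a - 1.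
        q powi ((b^2 div a - c) * choose2 (d + 1)
                + (b^2 div c - a) * choose2 (e + f + 1) + a * choose2 f)
        * jtheta (q powi ((b^2 div a - c) * (d + 1) + b * f) * y) (q powi (b^2 div a))
        * (- x) powi f
        * jtheta (q powi (b * (b^2 div (a * c) - 1) * (e + f + 1) - (b^2 div a - c) * (d + 1)
                          + (b^3 * (b - a)) div (2 * a^2 * c))
                    * (- x) powi (b div a) * inverse y)
                 (q powi ((b^2 div a) * (b^2 div (a * c) - 1)))
        * (J1 (b * (b^2 div (a * c) - 1)) q ^ 3
           * jtheta (q powi ((b^2 div c - a) * (e + 1) + (b^2 div a - c) * (d + 1)
                             - c * choose2 (b div c) - a * choose2 (b div a))
                       * (- x) powi (1 - b div a) * (- y) powi (1 - b div c))
                    (q powi (b * (b^2 div (a * c) - 1)))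
           / (theta_denom_e a b c x y q e * theta_denom_d a b c x y q d)))"

text \<open>
  Absence of poles on the right-hand side at \<open>z\<^sub>1 = z\<^sub>0 = -1\<close>. The prefactor
  \<open>1 / (J2_bar 0 (b\<^sup>2/a - c) q \<cdot> J2_bar 0 (b\<^sup>2/c - a) q)\<close> needs no separate condition: its factors
  are \<open>j(-1; Q)\<close> with \<open>0 < |Q| < 1\<close>, which never vanish.
\<close>

definition generic :: "int \<Rightarrow> int \<Rightarrow> int \<Rightarrow> complex \<Rightarrow> complex \<Rightarrow> complex \<Rightarrow> bool" where
  "generic a b c x y q \<longleftrightarrow>
     appell_lerch_no_pole (al_arg1 a b c x y q) (q powi (b^2 div a - c)) (-1) \<and>
     appell_lerch_no_pole (al_arg0 a b c x y q) (q powi (b^2 div c - a)) (-1) \<and>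
     (\<forall>e\<in>{0..b div a - 1}. theta_denom_e a b c x y q e \<noteq> 0) \<and>
     (\<forall>d\<in>{0..b div c - 1}. theta_denom_d a b c x y q d \<noteq> 0)"

end

theory Submission
  imports Defs
begin

text \<open>
  Write \<open>u = -x\<close>, \<open>v = -y\<close>, \<open>\<alpha> = b/a\<close>, \<open>\<gamma> = b/c\<close>, \<open>D = \<alpha>\<gamma> - 1\<close>, \<open>Q1 = q^(cD)\<close>, \<open>Q0 = q^(aD)\<close>. Multiply the
  identity by \<open>j(-1;Q1) j(-1;Q0)\<close> and expand all theta functions and geometric series. Then \<open>f\<close> and
  both Appell-Lerch terms become sums over \<open>(i,j,k,m) \<in> \<int>^4\<close> of one and the same monomial
  \<open>u^i v^j q^(a C(i,2) + bij + c C(j,2)) Q1^C(k,2) Q0^C(m,2)\<close>, and only their weights differ: these are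
  the means of the signs of \<open>(i, j)\<close>, \<open>(k-j, j)\<close> and \<open>(m-i, i)\<close>, respectively (with the
  sign changes of \<open>k-j\<close> and \<open>m-i\<close> moved according to the sizes of \<open>x\<close> and \<open>y\<close>). Adding up, the
  theta part must be the sum with the mean of the signs of \<open>(k-j, m-i)\<close>. The residues of \<open>k-j\<close>
  modulo \<open>\<gamma>\<close> and of \<open>m-i\<close> and of the remaining variable modulo \<open>\<alpha>\<close> are the indices \<open>d\<close>, \<open>e\<close>, \<open>f\<close>;
  for fixed residues the sum factors into two theta series and
  Kronecker's double sum \<open>\<Sum> \<plusminus> Q^(st) X^s Y^t = J^3 j(XY;Q) / (j(X;Q) j(Y;Q))\<close> with \<open>Q = q^(bD)\<close>.
  The expansions fail if some \<open>|Q1^k Y|\<close> or \<open>|Q0^k X|\<close> equals 1; those points are reached by continuity.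
\<close>

section \<open>Infinite sums over the integers\<close>

lemma choose2_double: "2 * choose2 n = n * (n - 1)"
  by (simp add: choose2_def)

lemma choose2_add: "choose2 (m + n) = choose2 m + choose2 n + m * n"
proof -
  have "2 * choose2 (m + n) = 2 * (choose2 m + choose2 n + m * n)"
    by (simp only: choose2_double distrib_left) (simp add: algebra_simps)
  thus ?thesis by simp
qed

lemma choose2_simps [simp]: "choose2 0 = 0" "choose2 1 = 0"
  by (simp_all add: choose2_def)

text \<open>Dominated convergence along an arbitrary filter: the majorant makes the finite partial
  sums converge uniformly (Weierstrass), so the two limits may be exchanged.\<close>

lemma tendsto_infsum_dominated:
  fixes f :: "'n \<Rightarrow> 'a \<Rightarrow> 'b::banach"
  assumes lim: "\<And>x. x \<in> A \<Longrightarrow> ((\<lambda>n. f n x) \<longlongrightarrow> g x) F"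
    and bound: "\<forall>\<^sub>F n in F. \<forall>x\<in>A. norm (f n x) \<le> h x"
    and h: "h summable_on A" and F: "F \<noteq> bot"
  shows "((\<lambda>n. infsum (f n) A) \<longlongrightarrow> infsum g A) F"
proof -
  define Y where "Y = {n. \<forall>x\<in>A. norm (f n x) \<le> h x}"
  have g: "norm (g x) \<le> h x" if "x \<in> A" for x
    using F
  proof (rule tendsto_upperbound[OF tendsto_norm[OF lim[OF that]], rotated])
    show "\<forall>\<^sub>F n in F. norm (f n x) \<le> h x"
      using bound by eventually_elim (use that in auto)
  qed
  have g_sum: "g summable_on A"
    by (rule abs_summable_summable, rule Infinite_Sum.abs_summable_on_comparison_test'[OF h g])
  show ?thesis
  proof (rule swap_uniform_limit')
    show "uniform_limit Y (\<lambda>X y. \<Sum>x\<in>X. f y x) (\<lambda>n. infsum (f n) A) (finite_subsets_at_top A)"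
      by (rule Weierstrass_m_test_general[OF _ h]) (auto simp: Y_def)
    show "\<forall>\<^sub>F X in finite_subsets_at_top A. ((\<lambda>n. \<Sum>x\<in>X. f n x) \<longlongrightarrow> (\<Sum>x\<in>X. g x)) F"
      by (intro eventually_finite_subsets_at_top_weakI tendsto_sum lim) auto
    show "(sum g \<longlongrightarrow> infsum g A) (finite_subsets_at_top A)"
      using g_sum by (rule infsum_tendsto)
    show "\<forall>\<^sub>F n in F. n \<in> Y"
      using bound by (simp add: Y_def)
  qed simp
qed

text \<open>For complex families summability is absolute summability, so the product family is
  absolutely summable and may be summed iteratively.\<close>

lemma has_sum_times:
  fixes f :: "'a \<Rightarrow> complex" and g :: "'b \<Rightarrow> complex"
  assumes f: "(f has_sum a) A" and g: "(g has_sum b) B"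
  shows "((\<lambda>(x, y). f x * g y) has_sum (a * b)) (A \<times> B)"
proof (rule has_sum_SigmaI)
  show "((\<lambda>y. case (x, y) of (x, y) \<Rightarrow> f x * g y) has_sum (f x * b)) B" for x
    using has_sum_cmult_right[OF g] by simp
  show "((\<lambda>x. f x * b) has_sum (a * b)) A"
    by (rule has_sum_cmult_left[OF f])
  have f': "(\<lambda>x. norm (f x)) summable_on A" and g': "(\<lambda>x. norm (g x)) summable_on B"
    using f g by (auto dest: has_sum_imp_summable simp: summable_on_iff_abs_summable_on_complex)
  have "(\<lambda>p. norm (case p of (x, y) \<Rightarrow> f x * g y)) summable_on A \<times> B"
  proof (rule summable_on_SigmaI)
    show "((\<lambda>y. norm (case (x, y) of (x, y) \<Rightarrow> f x * g y)) has_sum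
            (norm (f x) * (\<Sum>\<^sub>\<infinity>y\<in>B. norm (g y)))) B" for x
      using has_sum_cmult_right[OF has_sum_infsum[OF g'], of "norm (f x)"] by (simp add: norm_mult)
    show "(\<lambda>x. norm (f x) * (\<Sum>\<^sub>\<infinity>y\<in>B. norm (g y))) summable_on A"
      using summable_on_cmult_left[OF f'] .
  qed auto
  thus "(\<lambda>(x, y). f x * g y) summable_on A \<times> B"
    by (rule abs_summable_summable)
qed

lemma has_sum_int_halves:
  fixes f :: "int \<Rightarrow> 'a::{topological_comm_monoid_add, t2_space}"
  assumes "((\<lambda>n. f (int n)) has_sum s) UNIV" and "((\<lambda>n. f (- int n - 1)) has_sum t) UNIV"
  shows "(f has_sum (s + t)) UNIV"
proof -
  have "(f has_sum s) {0..}"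
    using assms(1)
    by (subst has_sum_reindex_bij_witness[of _ int nat UNIV "\<lambda>n. f (int n)" f _ s]) auto
  moreover have "(f has_sum t) {..<0}"
    using assms(2)
    by (subst has_sum_reindex_bij_witness[of _ "\<lambda>n. - int n - 1" "\<lambda>n. nat (- n - 1)" UNIV
          "\<lambda>n. f (- int n - 1)" f _ t]) auto
  ultimately have "(f has_sum (s + t)) ({0..} \<union> {..<0})"
    by (rule has_sum_Un_disjoint) auto
  moreover have "{0..} \<union> {..<0} = (UNIV :: int set)" by auto
  ultimately show ?thesis by simp
qed

lemma has_sum_int_shift:
  fixes f :: "int \<Rightarrow> 'a::{topological_comm_monoid_add, t2_space}"
  shows "((\<lambda>k. f (k + c)) has_sum s) UNIV \<longleftrightarrow> (f has_sum s) UNIV"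
  by (rule has_sum_reindex_bij_witness[of _ "\<lambda>k. k - c" "\<lambda>k. k + c"]) auto

section \<open>Absolute convergence of two-sided Gauss series\<close>

lemma summable_gauss_nat:
  fixes r z :: real
  assumes "0 < r" "r < 1" "0 < z"
  shows "summable (\<lambda>n. r powi choose2 (int n) * z ^ n)"
proof -
  have "(\<lambda>n. r ^ n * z) \<longlonglongrightarrow> 0 * z"
    using assms by (intro tendsto_intros LIMSEQ_power_zero) auto
  hence "eventually (\<lambda>n. r ^ n * z < 1 / 2) sequentially"
    by (rule order_tendstoD) simp
  then obtain N where N: "\<And>n. n \<ge> N \<Longrightarrow> r ^ n * z < 1 / 2"
    by (auto simp: eventually_sequentially)
  show ?thesis
  proof (rule summable_ratio_test[of "1/2" N])
    fix n assume n: "n \<ge> N"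
    have "r powi choose2 (int (Suc n)) * z ^ Suc n = r powi choose2 (int n) * z ^ n * (r ^ n * z)"
      using choose2_add[of "int n" 1] assms
      by (simp add: power_int_add add.commute algebra_simps)
    also have "\<dots> \<le> r powi choose2 (int n) * z ^ n * (1 / 2)"
      using N[OF n] assms by (intro mult_left_mono) auto
    finally show "norm (r powi choose2 (int (Suc n)) * z ^ Suc n)
        \<le> 1 / 2 * norm (r powi choose2 (int n) * z ^ n)"
      using assms by (simp add: abs_mult power_int_abs)
  qed simp
qed

lemma summable_on_gauss_real:
  fixes r z :: real
  assumes "0 < r" "r < 1" "0 < z"
  shows "(\<lambda>n. r powi choose2 n * z powi n) summable_on UNIV"
proof -
  have 1: "(\<lambda>n. r powi choose2 (int n) * z powi int n) summable_on UNIV"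
    using summable_gauss_nat[OF assms] assms
    by (intro norm_summable_imp_summable_on) (simp add: abs_mult power_int_abs)
  \<comment> \<open>Since C(-n-1, 2) = C(n, 2) + 2n + 1, the negative half is a constant multiple of
    the one-sided series with \<open>z\<close> replaced by \<open>r^2 / z\<close>.\<close>
  have eq: "r powi choose2 (- int n - 1) * z powi (- int n - 1)
      = (r / z) * (r powi choose2 (int n) * ((r ^ 2 / z) ^ n))" for n
  proof -
    have "2 * choose2 (- int n - 1) = 2 * (choose2 (int n) + 2 * int n + 1)"
      by (simp only: choose2_double distrib_left) (simp add: algebra_simps)
    hence "choose2 (- int n - 1) = choose2 (int n) + 2 * int n + 1" by simp
    hence "r powi choose2 (- int n - 1) = r powi choose2 (int n) * (r ^ 2) ^ n * r"
      using assms by (simp add: power_int_add power_int_mult)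
    moreover have "z powi (- int n - 1) = inverse (z ^ n) / z"
      using assms by (simp add: power_int_diff power_int_minus)
    ultimately show ?thesis
      by (simp add: power_divide field_simps)
  qed
  have "(\<lambda>n. (r / z) * (r powi choose2 (int n) * ((r ^ 2 / z) ^ n))) summable_on UNIV"
  proof (rule summable_on_cmult_right, rule norm_summable_imp_summable_on)
    show "summable (\<lambda>n. norm (r powi choose2 (int n) * (r\<^sup>2 / z) ^ n))"
      using summable_gauss_nat[of r "r^2 / z"] assms by (simp add: abs_mult power_int_abs)
  qed
  hence 2: "(\<lambda>n. r powi choose2 (- int n - 1) * z powi (- int n - 1)) summable_on UNIV"
    by (simp add: eq)
  show ?thesis
    using has_sum_int_halves[OF has_sum_infsum[OF 1] has_sum_infsum[OF 2]]
    by (rule has_sum_imp_summable)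
qed

lemma summable_on_gauss:
  fixes q z :: complex
  assumes "q \<noteq> 0" "norm q < 1" "z \<noteq> 0"
  shows "(\<lambda>n. norm (q powi choose2 n * z powi n)) summable_on UNIV"
  using summable_on_gauss_real[of "norm q" "norm z"] assms
  by (simp add: norm_mult norm_power_int)

section \<open>q-factorials and infinite q-products\<close>

definition qfac :: "complex \<Rightarrow> nat \<Rightarrow> complex" where
  "qfac q n = (\<Prod>i<n. 1 - q ^ i * q)"

text \<open>Reciprocal \<open>q\<close>-factorial, extended by 0 to negative indices, so that the recurrence
  \<open>rqfac_rec\<close> holds at every integer.\<close>

definition rqfac :: "complex \<Rightarrow> int \<Rightarrow> complex" where
  "rqfac q k = (if k < 0 then 0 else 1 / qfac q (nat k))"

lemma one_minus_q_power_nz: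
  fixes q :: complex
  assumes "norm q < 1" "n > 0"
  shows "1 - q ^ n \<noteq> 0"
proof
  assume "1 - q ^ n = 0"
  hence "norm (q ^ n) = 1" by simp
  moreover have "norm q ^ n < 1" using assms by (simp add: power_less_one_iff)
  ultimately show False by (simp add: norm_power)
qed

lemma qfac_nz: "norm q < 1 \<Longrightarrow> qfac q n \<noteq> 0"
  using one_minus_q_power_nz[of q "Suc i" for i] by (auto simp: qfac_def mult.commute)

text \<open>At \<open>k = 0\<close> the factor \<open>1 - q powi k\<close> vanishes, matching the
  value 0 at index -1; for negative \<open>k\<close> both sides are 0.\<close>

lemma rqfac_rec:
  assumes "norm q < 1"
  shows "(1 - q powi k) * rqfac q k = rqfac q (k - 1)"
proof (cases "k \<le> 0")
  case True
  thus ?thesis by (auto simp: rqfac_def)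
next
  case False
  then obtain n where n: "k = int (Suc n)"
    by (metis not_le zero_less_imp_eq_int Suc_pred)
  have "nat (int n + 1) = Suc n" by simp
  thus ?thesis
    using qfac_nz[OF assms, of n] one_minus_q_power_nz[OF assms, of "Suc n"]
    by (simp add: n rqfac_def qfac_def power_int_add_1 power_int_add mult.commute nat_add_distrib)
qed

lemma convergent_prod_qpoch:
  fixes q x :: complex
  assumes "norm q < 1"
  shows "convergent_prod (\<lambda>i. 1 - q ^ i * x)"
proof -
  have "summable (\<lambda>i. norm q ^ i * norm x)"
    using assms by (intro summable_mult2 summable_geometric) auto
  hence "summable (\<lambda>i. norm ((1 - q ^ i * x) - 1))"
    by (simp add: norm_mult norm_power)
  thus ?thesis
    by (intro abs_convergent_prod_imp_convergent_prod summable_imp_abs_convergent_prod)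
qed

lemma qpoch_inf_LIMSEQ:
  assumes "norm q < 1"
  shows "(\<lambda>n. \<Prod>i<n. 1 - q ^ i * x) \<longlonglongrightarrow> qpoch_inf x q"
  using convergent_prod_LIMSEQ[OF convergent_prod_qpoch[OF assms, of x]]
  unfolding qpoch_inf_def by (rule LIMSEQ_lessThan_iff_atMost[THEN iffD2])

lemma qpoch_inf_nz:
  assumes "norm q < 1" "\<And>i. q ^ i * x \<noteq> 1"
  shows "qpoch_inf x q \<noteq> 0"
  unfolding qpoch_inf_def
  by (rule prodinf_nonzero[OF convergent_prod_qpoch[OF assms(1)]]) (use assms(2) in auto)

lemma qpoch_inf_self_nz:
  assumes "norm q < 1"
  shows "qpoch_inf q q \<noteq> 0"
  using one_minus_q_power_nz[OF assms, of "Suc i" for i]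
  by (intro qpoch_inf_nz assms) (auto simp: mult.commute)

text \<open>The zeros of the product form are the integral powers of \<open>q\<close>: exponents k
  \<le> 0 come from (x;q), exponents k \<ge> 1 from (q/x;q), and (q;q) does not vanish.\<close>

lemma jtheta_nz:
  assumes q: "q \<noteq> 0" "norm q < 1" and x: "x \<noteq> 0" "\<And>k::int. x \<noteq> q powi k"
  shows "jtheta x q \<noteq> 0"
proof -
  have "qpoch_inf x q \<noteq> 0"
  proof (rule qpoch_inf_nz[OF q(2)])
    fix i
    show "q ^ i * x \<noteq> 1"
      using x(2)[of "- int i"] q by (auto simp: power_int_minus field_simps)
  qed
  moreover have "qpoch_inf (q / x) q \<noteq> 0"
  proof (rule qpoch_inf_nz[OF q(2)])
    fix i
    show "q ^ i * (q / x) \<noteq> 1"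
      using x(2)[of "int (Suc i)"] q x(1) by (auto simp: field_simps simp del: of_nat_Suc)
  qed
  ultimately show ?thesis
    using qpoch_inf_self_nz[OF q(2)] by (simp add: jtheta_def)
qed

lemma qfac_LIMSEQ: "norm q < 1 \<Longrightarrow> qfac q \<longlonglongrightarrow> qpoch_inf q q"
  using qpoch_inf_LIMSEQ[of q q] by (simp add: qfac_def[abs_def])

text \<open>A convergent sequence is bounded. This bound supplies the majorants when limits are
  taken under the infinite sums.\<close>

lemma rqfac_bounded:
  assumes "norm q < 1"
  obtains B where "\<And>k. norm (rqfac q k) \<le> B"
proof -
  have "(\<lambda>n. 1 / qfac q n) \<longlonglongrightarrow> 1 / qpoch_inf q q"
    using qpoch_inf_self_nz[OF assms] by (intro tendsto_intros qfac_LIMSEQ assms) auto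
  hence "Bseq (\<lambda>n. 1 / qfac q n)" by (rule convergentI[THEN convergent_imp_Bseq])
  then obtain B where "B > 0" "\<And>n. norm (1 / qfac q n) \<le> B"
    by (auto simp: Bseq_def)
  hence "norm (rqfac q k) \<le> B" for k by (auto simp: rqfac_def)
  thus ?thesis by (rule that)
qed

lemma rqfac_LIMSEQ:
  assumes "norm q < 1"
  shows "(\<lambda>n. rqfac q (int n + k)) \<longlonglongrightarrow> 1 / qpoch_inf q q"
proof -
  have "filterlim (\<lambda>n. nat (int n + k)) sequentially sequentially"
    unfolding filterlim_at_top
  proof
    fix Z :: nat
    show "\<forall>\<^sub>F n in sequentially. Z \<le> nat (int n + k)"
      using eventually_ge_at_top[of "Z + nat \<bar>k\<bar>"] by eventually_elim auto
  qed
  hence "(\<lambda>n. 1 / qfac q (nat (int n + k))) \<longlonglongrightarrow> 1 / qpoch_inf q q"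
    using qpoch_inf_self_nz[OF assms]
    by (intro tendsto_intros filterlim_compose[OF qfac_LIMSEQ] assms) auto
  moreover have "\<forall>\<^sub>F n in sequentially. 1 / qfac q (nat (int n + k)) = rqfac q (int n + k)"
    using eventually_ge_at_top[of "nat \<bar>k\<bar>"] by eventually_elim (auto simp: rqfac_def)
  ultimately show ?thesis by (rule Lim_transform_eventually)
qed

section \<open>The Jacobi triple product\<close>

lemma rqfac_zero_delta: "rqfac q k * rqfac q (- k) = (if k = 0 then 1 else 0)"
  by (auto simp: rqfac_def qfac_def)

text \<open>The finite q-binomial theorem: the three q-factorial factors form the Gaussian binomial
  coefficient. The zero convention of \<open>rqfac\<close> lets the sum run over all integers, so
  that index shifts produce no boundary terms.\<close>

lemma qbinomial_has_sum:
  assumes q: "q \<noteq> 0" "norm q < 1" and t: "t \<noteq> 0"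
  shows "((\<lambda>k. q powi choose2 k * (qfac q N * rqfac q k * rqfac q (int N - k)) * t powi k)
           has_sum (\<Prod>i<N. 1 + q ^ i * t)) UNIV"
proof (induction N)
  case 0
  show ?case
    by (rule has_sum_finite_neutralI[of "{0}"])
       (use rqfac_zero_delta[of q] in \<open>auto simp: qfac_def rqfac_def\<close>)
next
  case (Suc N)
  define c where "c = (\<lambda>k. q powi choose2 k * (qfac q N * rqfac q k * rqfac q (int N - k)) * t powi k)"
  have c: "(c has_sum (\<Prod>i<N. 1 + q ^ i * t)) UNIV"
    using Suc.IH by (simp add: c_def)
  have "((\<lambda>k. c k + q ^ N * t * c (k - 1)) has_sum
          ((\<Prod>i<N. 1 + q ^ i * t) + q ^ N * t * (\<Prod>i<N. 1 + q ^ i * t))) UNIV"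
    by (intro has_sum_add c has_sum_cmult_right) (use has_sum_int_shift[of c "- 1"] c in auto)
  moreover have "c k + q ^ N * t * c (k - 1) = q powi choose2 k *
      (qfac q (Suc N) * rqfac q k * rqfac q (int (Suc N) - k)) * t powi k" for k
  proof -
    define R where "R = rqfac q (int N + 1 - k)"
    define E where "E = q powi (int N + 1 - k)"
    have r1: "rqfac q (int N - k) = (1 - E) * R"
      using rqfac_rec[OF q(2), of "int N + 1 - k"] by (simp add: R_def E_def algebra_simps)
    have r2: "rqfac q (k - 1) = (1 - q powi k) * rqfac q k"
      using rqfac_rec[OF q(2), of k] by simp
    have r3: "rqfac q (int N - (k - 1)) = R" by (simp add: R_def algebra_simps)
    have e: "q powi choose2 k * E = q ^ N * q powi choose2 (k - 1)"
    proof -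
      have "choose2 k = choose2 (k - 1) + (k - 1)"
        using choose2_add[of "k - 1" 1] by simp
      hence "choose2 k + (int N + 1 - k) = int N + choose2 (k - 1)" by simp
      thus ?thesis using q unfolding E_def
        by (metis power_int_add power_int_of_nat)
    qed
    have e2: "E * q powi k = q ^ N * q"
      unfolding E_def using q by (simp flip: power_int_add add: power_int_add_1)
    have t1: "t * t powi (k - 1) = t powi k" using t by (simp add: power_int_diff)
    have "c k + q ^ N * t * c (k - 1) =
        qfac q N * rqfac q k * R * (t powi k) * q powi choose2 k * (1 - E) +
        qfac q N * (1 - q powi k) * rqfac q k * R * (t * t powi (k - 1)) * (q ^ N * q powi choose2 (k - 1))"
      by (simp add: c_def r1 r2 r3)
    \<comment> \<open>The q-Pascal rule: (1 - E) + (1 - q^k) E = 1 - E q^k, and this equals 1 -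
      q^(N+1), the new factor of \<open>qfac q (Suc N)\<close>.\<close>
    also have "\<dots> = qfac q N * rqfac q k * R * (t powi k) * q powi choose2 k * (1 - E * q powi k)"
      unfolding t1 e[symmetric] by (simp add: algebra_simps)
    also have "\<dots> = q powi choose2 k *
      (qfac q (Suc N) * rqfac q k * rqfac q (int (Suc N) - k)) * t powi k"
      by (simp add: e2 qfac_def R_def algebra_simps)
    finally show ?thesis .
  qed
  ultimately show ?case by (simp add: algebra_simps)
qed

text \<open>Reverse the order of the factors and take u / q^(i+1) out of each; the extracted
  exponents add up to 1 + ... + n = C(n+1, 2).\<close>

lemma prod_reflect_split:
  fixes q u :: complex
  assumes "q \<noteq> 0" "u \<noteq> 0"
  shows "(\<Prod>i<n. 1 + q ^ i * (u / q ^ n)) =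
    u ^ n * q powi (- choose2 (int n + 1)) * (\<Prod>i<n. 1 + q ^ i * (q / u))"
proof -
  have "(\<Prod>i<n. 1 + q ^ i * (u / q ^ n)) = (\<Prod>i<n. 1 + q ^ (n - Suc i) * (u / q ^ n))"
    by (rule prod.nat_diff_reindex[symmetric])
  also have "\<dots> = (\<Prod>i<n. (u / q ^ Suc i) * (1 + q ^ i * (q / u)))"
  proof (rule prod.cong)
    fix i assume "i \<in> {..<n}"
    hence "q ^ n = q ^ (n - Suc i) * q ^ Suc i" by (subst power_add[symmetric]) auto
    thus "1 + q ^ (n - Suc i) * (u / q ^ n) = (u / q ^ Suc i) * (1 + q ^ i * (q / u))"
      using assms by (simp add: field_simps)
  qed simp
  also have "\<dots> = (\<Prod>i<n. u / q ^ Suc i) * (\<Prod>i<n. 1 + q ^ i * (q / u))"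
    by (rule prod.distrib)
  also have "(\<Prod>i<n. u / q ^ Suc i) = u ^ n * q powi (- choose2 (int n + 1))"
  proof (induction n)
    case (Suc n)
    have "choose2 (int (Suc n) + 1) = choose2 (int n + 1) + int (Suc n)"
      using choose2_add[of "int n + 1" 1] by (simp add: algebra_simps)
    hence "q powi (- choose2 (int (Suc n) + 1)) = q powi (- choose2 (int n + 1)) / q ^ Suc n"
      using assms power_int_add[of q "- choose2 (int n + 1)" "- int (Suc n)"]
      by (simp add: power_int_minus divide_inverse del: of_nat_Suc)
    thus ?case using Suc.IH by simp
  qed simp
  finally show ?thesis .
qed

lemma prod_lessThan_add:
  fixes f :: "nat \<Rightarrow> 'a::comm_monoid_mult"
  shows "(\<Prod>i<m + n. f i) = (\<Prod>i<m. f i) * (\<Prod>i<n. f (i + m))"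
  by (induction n) (simp_all add: mult.assoc add.commute)

text \<open>The q-binomial theorem with N = 2n and t = u / q^n, recentred by k -> k + n. Half of the
  product has the required form already; the other half is reflected, and the prefactor
  \<open>W\<close> cancels against the recentring.\<close>

lemma finite_triple_product:
  assumes q: "q \<noteq> 0" "norm q < 1" and u: "u \<noteq> 0"
  shows "((\<lambda>k. q powi choose2 k * u powi k * (qfac q (2 * n) * rqfac q (int n + k) * rqfac q (int n - k)))
           has_sum ((\<Prod>i<n. 1 - q ^ i * (- u)) * (\<Prod>i<n. 1 - q ^ i * (q / - u)))) UNIV"
proof -
  define t where "t = u / q ^ n"
  define W where "W = u ^ n * q powi (- choose2 (int n + 1))"
  have W: "W \<noteq> 0" using q u by (simp add: W_def)
  have t: "t \<noteq> 0" using q u by (simp add: t_def)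
  define c where "c = (\<lambda>k. q powi choose2 k *
    (qfac q (2 * n) * rqfac q k * rqfac q (int (2 * n) - k)) * t powi k)"
  have "(c has_sum (\<Prod>i<2 * n. 1 + q ^ i * t)) UNIV"
    unfolding c_def by (rule qbinomial_has_sum[OF q t])
  hence "((\<lambda>k. inverse W * c (k + int n)) has_sum (inverse W * (\<Prod>i<2 * n. 1 + q ^ i * t))) UNIV"
    by (intro has_sum_cmult_right) (simp add: has_sum_int_shift)
  moreover have "(\<Prod>i<2 * n. 1 + q ^ i * t) = W * ((\<Prod>i<n. 1 + q ^ i * u) * (\<Prod>i<n. 1 + q ^ i * (q / u)))"
    unfolding mult_2 prod_lessThan_add using prod_reflect_split[OF q(1) u, of n] q
    by (simp add: t_def W_def power_add algebra_simps)
  moreover have "inverse W * c (k + int n) = q powi choose2 k * u powi k *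
      (qfac q (2 * n) * rqfac q (int n + k) * rqfac q (int n - k))" for k
  proof -
    have "2 * (choose2 (k + int n) - int n * (k + int n) + choose2 (int n + 1)) = 2 * choose2 k"
      by (simp only: choose2_double distrib_left right_diff_distrib) (simp add: algebra_simps)
    hence e: "choose2 (k + int n) - int n * (k + int n) + choose2 (int n + 1) = choose2 k" by simp
    have "t powi (k + int n) = u powi k * u ^ n * q powi (- (int n * (k + int n)))"
      using q u by (simp add: t_def power_int_divide_distrib power_int_add power_int_minus
          power_int_mult divide_simps)
    moreover have "inverse W = q powi choose2 (int n + 1) / u ^ n"
      using q by (simp add: W_def power_int_minus divide_simps)
    ultimately have "inverse W * c (k + int n) =
      (q powi choose2 (k + int n) * q powi (- (int n * (k + int n))) * q powi choose2 (int n + 1)) *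
       u powi k * (qfac q (2 * n) * rqfac q (int n + k) * rqfac q (int n - k))"
      using u by (simp add: c_def add.commute)
    also have "q powi choose2 (k + int n) * q powi (- (int n * (k + int n))) * q powi choose2 (int n + 1)
        = q powi choose2 k"
      using q e by (simp flip: power_int_add)
    finally show ?thesis .
  qed
  ultimately show ?thesis using W by (simp flip: mult.assoc)
qed

text \<open>Let n tend to infinity in the finite identity: the q-factorials leave the factor 1/P on
  the series side, and multiplying by P gives the third product of \<open>jtheta\<close>. With
  argument \<open>- u\<close> the series carries no signs.\<close>

theorem jacobi_triple_product:
  assumes q: "q \<noteq> 0" "norm q < 1" and u: "u \<noteq> 0"
  shows "((\<lambda>k. q powi choose2 k * u powi k) has_sum jtheta (- u) q) UNIV"
proof -
  define P where "P = qpoch_inf q q"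
  have P: "P \<noteq> 0" using qpoch_inf_self_nz[OF q(2)] by (simp add: P_def)
  define f where "f = (\<lambda>n k. q powi choose2 k * u powi k *
      (qfac q (2 * n) * rqfac q (int n + k) * rqfac q (int n - k)))"
  obtain B where B: "\<And>k. norm (rqfac q k) \<le> B" by (rule rqfac_bounded[OF q(2)]) auto
  have B0: "B \<ge> 0" using order_trans[OF norm_ge_zero B] .
  have "Bseq (qfac q)" using qfac_LIMSEQ[OF q(2)] by (rule convergentI[THEN convergent_imp_Bseq])
  then obtain C where C: "C > 0" "\<And>n. norm (qfac q n) \<le> C" by (auto simp: Bseq_def)
  note sum = summable_on_gauss[OF q u]
  have lim: "(\<lambda>n. infsum (f n) UNIV) \<longlonglongrightarrow> (\<Sum>\<^sub>\<infinity>k. q powi choose2 k * u powi k * (P * (1 / P) * (1 / P)))"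
  proof (rule tendsto_infsum_dominated)
    fix k :: int
    have "(\<lambda>n. qfac q (2 * n)) \<longlonglongrightarrow> P"
      unfolding P_def
      by (rule filterlim_compose[OF qfac_LIMSEQ[OF q(2)]])
         (intro filterlim_subseq strict_monoI, simp)
    thus "(\<lambda>n. f n k) \<longlonglongrightarrow> q powi choose2 k * u powi k * (P * (1 / P) * (1 / P))"
      using rqfac_LIMSEQ[OF q(2), of k] rqfac_LIMSEQ[OF q(2), of "- k"] unfolding f_def P_def
      by (intro tendsto_mult tendsto_const) auto
  next
    show "\<forall>\<^sub>F n in sequentially. \<forall>k\<in>UNIV. norm (f n k) \<le> norm (q powi choose2 k * u powi k) * (C * B * B)"
      unfolding f_def norm_mult[of "_ * _" "_ * _ * _"] norm_mult[of "_ * _" "rqfac _ _"] norm_mult[of _ "rqfac _ _"]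
      by (intro always_eventually allI ballI mult_left_mono mult_mono mult_nonneg_nonneg B C less_imp_le[OF C(1)] B0) auto
    show "(\<lambda>k. norm (q powi choose2 k * u powi k) * (C * B * B)) summable_on UNIV"
      by (rule summable_on_cmult_left[OF sum])
  qed simp
  have eq: "infsum (f n) UNIV = (\<Prod>i<n. 1 - q ^ i * (- u)) * (\<Prod>i<n. 1 - q ^ i * (q / - u))" for n
    unfolding f_def by (rule infsumI[OF finite_triple_product[OF q u]])
  have lim': "(\<lambda>n. (\<Prod>i<n. 1 - q ^ i * (- u)) * (\<Prod>i<n. 1 - q ^ i * (q / - u)))
      \<longlonglongrightarrow> qpoch_inf (- u) q * qpoch_inf (q / - u) q"
    by (intro tendsto_mult qpoch_inf_LIMSEQ q)
  have "(\<Sum>\<^sub>\<infinity>k. q powi choose2 k * u powi k * (P * (1 / P) * (1 / P)))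
      = qpoch_inf (- u) q * qpoch_inf (q / - u) q"
    using lim[unfolded eq] lim' by (rule LIMSEQ_unique)
  hence "(\<Sum>\<^sub>\<infinity>k. q powi choose2 k * u powi k) * (1 / P) = qpoch_inf (- u) q * qpoch_inf (q / - u) q"
    using P by (simp only: infsum_cmult_left') simp
  hence "(\<Sum>\<^sub>\<infinity>k. q powi choose2 k * u powi k) = jtheta (- u) q"
    using P by (simp add: jtheta_def P_def field_simps)
  thus ?thesis
    using has_sum_infsum[OF abs_summable_summable[OF sum]] by simp
qed

section \<open>Theta series: the value at -1 and quasi-periodicity\<close>

lemma jtheta_has_sum:
  assumes q: "q \<noteq> 0" "norm q < 1" and x: "x \<noteq> 0"
  shows "((\<lambda>k. q powi choose2 k * (- x) powi k) has_sum jtheta x q) UNIV"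
  using jacobi_triple_product[of q "- x"] assms by simp

lemma theta_one_has_sum:
  assumes "z \<noteq> 0" "norm z < 1"
  shows "((\<lambda>k. z powi choose2 k) has_sum jtheta (-1) z) UNIV"
  using jacobi_triple_product[OF assms, of 1] by simp

text \<open>-1 is not an integral power of \<open>z\<close>: comparing absolute values forces the
  exponent 0.\<close>

lemma jtheta_minus_one_nz:
  assumes "z \<noteq> 0" "norm z < 1"
  shows "jtheta (-1) z \<noteq> 0"
proof (rule jtheta_nz[OF assms])
  fix k :: int
  show "- 1 \<noteq> z powi k"
  proof
    assume k: "- 1 = z powi k"
    hence "norm z powi k = 1" by (metis norm_minus_cancel norm_one norm_power_int)
    moreover have "norm z powi k < 1" if "k > 0"
      using power_int_strict_decreasing[of 0 k "norm z"] assms that by simp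
    moreover have "norm z powi k > 1" if "k < 0"
      using power_int_strict_decreasing[of k 0 "norm z"] assms that by simp
    ultimately have "k = 0" by (metis less_irrefl linorder_neqE)
    thus False using k by simp
  qed
qed simp

text \<open>Quasi-periodicity, read off from the theta series by the shift k -> k + n.\<close>

lemma jtheta_shift:
  assumes q: "q \<noteq> 0" "norm q < 1" and x: "x \<noteq> 0"
  shows "jtheta (q powi n * x) q = q powi (- choose2 n) * (- x) powi (- n) * jtheta x q"
proof -
  have "((\<lambda>k. q powi (- choose2 n) * (- x) powi (- n) * (q powi choose2 (k + n) * (- x) powi (k + n)))
      has_sum (q powi (- choose2 n) * (- x) powi (- n) * jtheta x q)) UNIV"
    using has_sum_int_shift[of "\<lambda>k. q powi choose2 k * (- x) powi k" n] jtheta_has_sum[OF q x]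
    by (intro has_sum_cmult_right) auto
  moreover have "q powi (- choose2 n) * (- x) powi (- n) * (q powi choose2 (k + n) * (- x) powi (k + n))
      = q powi choose2 k * (- (q powi n * x)) powi k" for k
  proof -
    have "q powi choose2 (k + n) = q powi choose2 k * q powi choose2 n * (q powi n) powi k"
      using q by (simp add: choose2_add power_int_add power_int_mult mult.commute[of k])
    moreover have "(- (q powi n * x)) powi k = (q powi n) powi k * (- x) powi k"
      by (metis mult_minus_right power_int_mult_distrib)
    ultimately show ?thesis
      using q x by (simp add: power_int_minus power_int_add field_simps)
  qed
  moreover have "((\<lambda>k. q powi choose2 k * (- (q powi n * x)) powi k) has_sum jtheta (q powi n * x) q) UNIV"
    by (rule jtheta_has_sum) (use q x in auto)
  ultimately show ?thesis by (simp add: has_sum_unique)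
qed

section \<open>Partial fractions of a reciprocal theta function\<close>

lemma has_sum_minus:
  fixes f g :: "'a \<Rightarrow> complex"
  assumes "(f has_sum a) A" "(g has_sum b) A"
  shows "((\<lambda>x. f x - g x) has_sum (a - b)) A"
  using has_sum_add[OF assms(1) has_sum_uminusI[OF assms(2)]] by simp

text \<open>Partial fractions in \<open>t\<close> with simple poles at q^(-k), 0 \<le> k \<le> N;
  \<open>m \<le> N\<close> makes the fraction proper. Instead of computing residues, the induction
  combines the hypotheses at \<open>t\<close> and \<open>q * t\<close>, whose denominators are the
  new product without its last and without its first factor.\<close>

lemma finite_partial_fractions:
  assumes q: "q \<noteq> 0" "norm q < 1" and t: "t \<noteq> 0" "\<And>k::int. q powi k * t \<noteq> 1" and "m \<le> N"
  shows "((\<lambda>k. (-1) powi k * q powi (choose2 (k + 1) - int m * k) * rqfac q k * rqfac q (int N - k)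
             / (1 - q powi k * t))
           has_sum (t ^ m / (\<Prod>i<Suc N. 1 - q ^ i * t))) UNIV"
  using t \<open>m \<le> N\<close>
proof (induction N arbitrary: m t)
  case 0
  thus ?case
    by (intro has_sum_finite_neutralI[of "{0}"])
       (use rqfac_zero_delta[of q] in \<open>auto simp: qfac_def rqfac_def\<close>)
next
  case (Suc N)
  define E where "E = q ^ Suc N"
  \<comment> \<open>Truncated subtraction: \<open>m' = 0\<close> when \<open>m = 0\<close>, so that
    case keeps its numerator exponent and needs its own combination.\<close>
  define m' where "m' = m - 1"
  have m': "m' \<le> N" using Suc.prems by (simp add: m'_def)
  have q1: "1 - E \<noteq> 0" using one_minus_q_power_nz[OF q(2), of "Suc N"] by (simp add: E_def)
  have qt: "q * t \<noteq> 0" "\<And>k::int. q powi k * (q * t) \<noteq> 1"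
    using Suc.prems(1) Suc.prems(2)[of "k + 1" for k] q by (auto simp: power_int_add mult.assoc)
  define w where "w = (\<lambda>m N k. (-1) powi k * q powi (choose2 (k + 1) - int m * k) * rqfac q k * rqfac q (int N - k))"
  define F where "F = (\<lambda>N t. \<Prod>i<Suc N. 1 - q ^ i * t)"
  have nz: "1 - q ^ i * t \<noteq> 0" for i
    using Suc.prems(2)[of "int i"] by simp
  have F0: "F N t \<noteq> 0" "F (Suc N) t \<noteq> 0" for N
    using nz by (auto simp: F_def simp del: prod.lessThan_Suc)
  have F1: "F (Suc N) t = F N t * (1 - E * t)"
    by (simp add: F_def E_def)
  have F2: "F (Suc N) t = (1 - t) * F N (q * t)"
    unfolding F_def by (subst prod.lessThan_Suc_shift) (simp add: o_def mult.assoc mult.left_commute)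
  have G1: "1 / F N t = (1 - E * t) / F (Suc N) t"
    using F0(2)[of N] unfolding F1 by simp
  have G2: "1 / F N (q * t) = (1 - t) / F (Suc N) t"
    using F0(2)[of N] unfolding F2 by simp
  have IH: "((\<lambda>k. w m' N k / (1 - q powi k * t)) has_sum (t ^ m' / F N t)) UNIV"
    unfolding w_def F_def by (rule Suc.IH[OF Suc.prems(1,2) m'])
  have "((\<lambda>k. w m' N k / (1 - q powi k * (q * t))) has_sum ((q * t) ^ m' / F N (q * t))) UNIV"
    unfolding w_def F_def by (rule Suc.IH[OF qt m'])
  hence IH2: "((\<lambda>k. w m' N (k + -1) / (1 - q powi (k + -1) * (q * t))) has_sum ((q * t) ^ m' / F N (q * t))) UNIV"
    by (subst has_sum_int_shift[where f = "\<lambda>k. w m' N k / (1 - q powi k * (q * t))"])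
  have IH2': "((\<lambda>k. w m' N (k - 1) / (1 - q powi k * t)) has_sum ((q * t) ^ m' / F N (q * t))) UNIV"
    using IH2 q by (simp add: power_int_diff)
  have r1: "rqfac q (int N - k) = (1 - q powi (int N + 1 - k)) * rqfac q (int N + 1 - k)" for k
    using rqfac_rec[OF q(2), of "int N + 1 - k"] by (simp add: algebra_simps)
  have r2: "rqfac q (k - 1) = (1 - q powi k) * rqfac q k" for k
    using rqfac_rec[OF q(2), of k] by simp
  have r3: "rqfac q (int N - (k - 1)) = rqfac q (int N + 1 - k)" for k
    by (simp add: algebra_simps)
  have sgn: "(-1 :: complex) powi (k - 1) = - ((-1) powi k)" for k
    by (simp add: power_int_diff)
  have ch: "choose2 (k - 1 + 1) = choose2 (k + 1) - k" for k
    using choose2_add[of k 1] by simp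
  have Ek: "q powi (int N + 1 - k) = E / q powi k" for k
    using q by (simp add: E_def power_int_diff power_int_add mult.commute)
  have S: "int (Suc N) - k = int N + 1 - k" for k by simp
  have inv_comb: "inverse e * (a / z - g * (b / z)) = c / z" if "a - g * b = e * c" "e \<noteq> 0"
    for a b c e g z :: complex
  proof -
    have "inverse e * (a / z - g * (b / z)) = inverse e * ((a - g * b) / z)"
      by (simp add: diff_divide_distrib)
    thus ?thesis using that by simp
  qed
  \<comment> \<open>For \<open>m = 0\<close> the numerators combine by (1 - E t) - E (1 - t) = 1 -
    E; otherwise (1 - E t) - (1 - t) = (1 - E) t raises the power of \<open>t\<close>, where
    \<open>G\<close> cancels the q^m' in (q t)^m'.\<close>
  show ?case
  proof (cases "m = 0")
    case True
    have "((\<lambda>k. inverse (1 - E) * (w m' N k / (1 - q powi k * t) - E * (w m' N (k - 1) / (1 - q powi k * t))))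
       has_sum (inverse (1 - E) * (t ^ m' / F N t - E * ((q * t) ^ m' / F N (q * t))))) UNIV"
      by (intro has_sum_cmult_right has_sum_minus IH IH2')
    moreover have "inverse (1 - E) * (w m' N k / (1 - q powi k * t) - E * (w m' N (k - 1) / (1 - q powi k * t)))
        = w m (Suc N) k / (1 - q powi k * t)" for k
    proof -
      have "w m' N k - E * w m' N (k - 1) = (1 - E) * w m (Suc N) k"
        unfolding w_def r3 r2 sgn ch unfolding r1 Ek S using q True
        by (simp add: m'_def power_int_diff field_simps)
      thus ?thesis using q1 by (rule inv_comb)
    qed
    moreover have "inverse (1 - E) * (t ^ m' / F N t - E * ((q * t) ^ m' / F N (q * t))) = t ^ m / F (Suc N) t"
    proof -
      have "t ^ m' / F N t - E * ((q * t) ^ m' / F N (q * t)) = ((1 - E * t) - E * (1 - t)) / F (Suc N) t"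
        using True G1 G2 by (simp add: m'_def diff_divide_distrib right_diff_distrib)
      also have "(1 - E * t) - E * (1 - t) = 1 - E" by (simp add: algebra_simps)
      finally show ?thesis using q1 True by simp
    qed
    ultimately show ?thesis by (simp only: w_def F_def)
  next
    case False
    hence m: "m = Suc m'" by (simp add: m'_def)
    define G where "G = inverse (q ^ m')"
    have "((\<lambda>k. inverse (1 - E) * (w m' N k / (1 - q powi k * t) - G * (w m' N (k - 1) / (1 - q powi k * t))))
       has_sum (inverse (1 - E) * (t ^ m' / F N t - G * ((q * t) ^ m' / F N (q * t))))) UNIV"
      by (intro has_sum_cmult_right has_sum_minus IH IH2')
    moreover have "inverse (1 - E) * (w m' N k / (1 - q powi k * t) - G * (w m' N (k - 1) / (1 - q powi k * t)))
        = w m (Suc N) k / (1 - q powi k * t)" for k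
    proof -
      have e1: "q powi (choose2 (k + 1) - int m' * k) = q powi (choose2 (k + 1) - int m * k) * q powi k"
        using q by (simp add: m flip: power_int_add) (simp add: algebra_simps)
      have e2: "q powi (choose2 (k + 1) - k - int m' * (k - 1)) = q powi (choose2 (k + 1) - int m * k) * q ^ m'"
        using q by (simp add: m flip: power_int_of_nat power_int_add) (simp add: algebra_simps)
      have "w m' N k - G * w m' N (k - 1) = (1 - E) * w m (Suc N) k"
        unfolding w_def r3 r2 sgn ch e1 e2 unfolding r1 Ek S using q
        by (simp add: G_def field_simps)
      thus ?thesis using q1 by (rule inv_comb)
    qed
    moreover have "inverse (1 - E) * (t ^ m' / F N t - G * ((q * t) ^ m' / F N (q * t))) = t ^ m / F (Suc N) t"
    proof -
      have "t ^ m' / F N t = t ^ m' * (1 - E * t) / F (Suc N) t" "G * ((q * t) ^ m' / F N (q * t)) = t ^ m' * (1 - t) / F (Suc N) t"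
        using arg_cong[OF G1, of "\<lambda>z. t ^ m' * z"] arg_cong[OF G2, of "\<lambda>z. t ^ m' * z"] q
        by (simp_all add: power_mult_distrib G_def flip: mult.assoc)
      hence "t ^ m' / F N t - G * ((q * t) ^ m' / F N (q * t)) = (t ^ m' * (1 - E * t) - t ^ m' * (1 - t)) / F (Suc N) t"
        by (simp add: diff_divide_distrib)
      also have "t ^ m' * (1 - E * t) - t ^ m' * (1 - t) = (1 - E) * t ^ m" by (simp add: m algebra_simps)
      finally show ?thesis using q1 by simp
    qed
    ultimately show ?thesis by (simp only: w_def F_def)
  qed
qed

text \<open>Near \<open>Y\<close> the modulus of q^k Z is at most 1/2 for large k and at least 2 for
  very negative k; the finitely many remaining k are handled by continuity. Uniformity in both k and
  Z provides a majorant for Appell sums under a limit.\<close>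

lemma one_minus_bounded_below:
  fixes q Y :: complex
  assumes q: "q \<noteq> 0" "norm q < 1" and Y: "Y \<noteq> 0" "\<And>k::int. q powi k * Y \<noteq> 1"
  obtains \<delta> where "\<delta> > 0" "\<forall>\<^sub>F Z in nhds Y. \<forall>k::int. \<delta> \<le> norm (1 - q powi k * Z)"
proof -
  define r where "r = norm q"
  have r: "0 < r" "r < 1" using q by (auto simp: r_def)
  have "(\<lambda>n. r ^ n) \<longlonglongrightarrow> 0" using r by (intro LIMSEQ_power_zero) auto
  moreover have "0 < min (1 / (4 * norm Y)) (norm Y / 4)" using Y by simp
  ultimately have "\<forall>\<^sub>F n in sequentially. r ^ n < min (1 / (4 * norm Y)) (norm Y / 4)"
    by (rule order_tendstoD)
  \<comment> \<open>The constants fit |Y|/2 < |Z| < 2|Y|: they give |q^k Z| \<le> 1/2 for k \<ge> M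
    and |q^k Z| \<ge> 2 for k \<le> -M.\<close>
  then obtain M where M: "r ^ M < 1 / (4 * norm Y)" "r ^ M < norm Y / 4"
    by (auto simp: eventually_sequentially)
  define K where "K = {- int M..int M}"
  define \<delta>' where "\<delta>' = Min ((\<lambda>k. norm (1 - q powi k * Y)) ` K)"
  have K: "finite K" "K \<noteq> {}" by (auto simp: K_def)
  have "\<delta>' \<in> (\<lambda>k. norm (1 - q powi k * Y)) ` K"
    unfolding \<delta>'_def using K by (intro Min_in) auto
  hence \<delta>': "\<delta>' > 0" using Y(2) by fastforce
  have \<delta>'_le: "\<delta>' \<le> norm (1 - q powi k * Y)" if "k \<in> K" for k
    unfolding \<delta>'_def using K that by (intro Min_le) auto
  have ev1: "\<forall>\<^sub>F Z in nhds Y. \<forall>k\<in>K. \<delta>' / 2 < norm (1 - q powi k * Z)"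
  proof (rule eventually_ball_finite[OF K(1)], rule ballI)
    fix k assume k: "k \<in> K"
    have "((\<lambda>Z. norm (1 - q powi k * Z)) \<longlongrightarrow> norm (1 - q powi k * Y)) (nhds Y)"
      by (intro tendsto_intros filterlim_ident)
    thus "\<forall>\<^sub>F Z in nhds Y. \<delta>' / 2 < norm (1 - q powi k * Z)"
      by (rule order_tendstoD) (use \<delta>'_le[OF k] \<delta>' in linarith)
  qed
  have nY: "((\<lambda>Z. norm Z) \<longlongrightarrow> norm Y) (nhds Y)"
    by (intro tendsto_intros filterlim_ident)
  have ev2: "\<forall>\<^sub>F Z in nhds Y. norm Z < 2 * norm Y" and ev3: "\<forall>\<^sub>F Z in nhds Y. norm Y / 2 < norm Z"
    by (rule order_tendstoD[OF nY], use Y in simp)+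
  define \<delta> where "\<delta> = min (\<delta>' / 2) (1 / 2)"
  show ?thesis
  proof (rule that)
    show "\<delta> > 0" using \<delta>' by (simp add: \<delta>_def)
    show "\<forall>\<^sub>F Z in nhds Y. \<forall>k::int. \<delta> \<le> norm (1 - q powi k * Z)"
      using ev1 ev2 ev3
    proof eventually_elim
      case (elim Z)
      show ?case
      proof
        fix k :: int
        consider "k \<in> K" | "k \<ge> int M" | "k \<le> - int M" by (force simp: K_def)
        thus "\<delta> \<le> norm (1 - q powi k * Z)"
        proof cases
          case 1
          thus ?thesis using elim(1) by (auto simp: \<delta>_def)
        next
          case 2
          have "norm (q powi k * Z) = r powi k * norm Z" by (simp add: norm_mult norm_power_int r_def)
          also have "\<dots> \<le> r powi int M * norm Z"
            using 2 r by (intro mult_right_mono power_int_decreasing) auto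
          also have "\<dots> \<le> 1 / (4 * norm Y) * (2 * norm Y)"
            using M elim by (intro mult_mono) auto
          finally have "norm (q powi k * Z) \<le> 1 / 2" using Y by simp
          moreover have "norm (1 - q powi k * Z) \<ge> norm (1::complex) - norm (q powi k * Z)"
            by (rule norm_triangle_ineq2)
          ultimately show ?thesis by (simp add: \<delta>_def)
        next
          case 3
          have "2 \<le> inverse (r ^ M) * (norm Y / 2)"
            using M(2) r by (simp add: field_simps)
          also have "\<dots> \<le> inverse (r ^ M) * norm Z"
            using elim r by (intro mult_left_mono) auto
          also have "inverse (r ^ M) = r powi (- int M)" by (simp add: power_int_minus)
          also have "r powi (- int M) * norm Z \<le> r powi k * norm Z"
            using 3 r by (intro mult_right_mono power_int_decreasing) auto
          also have "\<dots> = norm (q powi k * Z)" by (simp add: norm_mult norm_power_int r_def)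
          finally have "norm (q powi k * Z) \<ge> 2" .
          moreover have "norm (q powi k * Z - 1) \<ge> norm (q powi k * Z) - norm (1::complex)"
            by (rule norm_triangle_ineq2)
          ultimately show ?thesis by (simp add: \<delta>_def norm_minus_commute)
        qed
      qed
    qed
  qed
qed

lemma one_minus_bounded_below_at:
  fixes q Y :: complex
  assumes "q \<noteq> 0" "norm q < 1" "Y \<noteq> 0" "\<And>k::int. q powi k * Y \<noteq> 1"
  obtains \<delta> where "\<delta> > 0" "\<And>k::int. \<delta> \<le> norm (1 - q powi k * Y)"
  using one_minus_bounded_below[OF assms] eventually_nhds_x_imp_x by metis

text \<open>The finite partial fractions with N = 2n, m = n and t = Y / q^n have indices 0..2n;
  recentring makes them -n..n, and n tends to infinity. Two of the factors P in the cube come from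
  the limits of the reciprocal q-factorials, the third from \<open>jtheta\<close> itself.\<close>

lemma reciprocal_jtheta_has_sum:
  assumes q: "q \<noteq> 0" "norm q < 1" and Y: "Y \<noteq> 0" "\<And>k::int. q powi k * Y \<noteq> 1"
  shows "((\<lambda>k. (-1) powi k * q powi choose2 (k + 1) / (1 - q powi k * Y))
           has_sum (qpoch_inf q q ^ 3 / jtheta Y q)) UNIV"
proof -
  define P where "P = qpoch_inf q q"
  have P: "P \<noteq> 0" using qpoch_inf_self_nz[OF q(2)] by (simp add: P_def)
  obtain B where B: "\<And>k. norm (rqfac q k) \<le> B" by (rule rqfac_bounded[OF q(2)]) auto
  have B0: "B \<ge> 0" using order_trans[OF norm_ge_zero B] .
  obtain \<delta> where \<delta>: "\<delta> > 0" "\<And>k::int. \<delta> \<le> norm (1 - q powi k * Y)"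
    using one_minus_bounded_below_at[OF q Y] by blast
  define g where "g = (\<lambda>k. (-1) powi k * q powi choose2 (k + 1) / (1 - q powi k * Y))"
  define h where "h = (\<lambda>k. norm (q powi choose2 (k + 1) * 1 powi (k + 1)) / \<delta>)"
  have gh: "norm (g k) \<le> h k" for k
    using \<delta>(2)[of k] \<delta>(1) by (simp add: g_def h_def norm_mult norm_divide norm_power_int frac_le)
  have "(\<lambda>k. norm (q powi choose2 k * 1 powi k) / \<delta>) summable_on UNIV"
    using summable_on_cmult_left[OF summable_on_gauss[OF q, of 1], of "inverse \<delta>"]
    by (simp add: divide_inverse)
  hence h: "h summable_on UNIV"
    using has_sum_int_shift[of "\<lambda>k. norm (q powi choose2 k * 1 powi k) / \<delta>" 1]
    unfolding h_def summable_on_def by blast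
  have g: "g summable_on UNIV"
    by (rule abs_summable_summable, rule Infinite_Sum.abs_summable_on_comparison_test'[OF h gh])
  define f where "f = (\<lambda>n k. g k * (rqfac q (int n + k) * rqfac q (int n - k)))"
  have lim: "(\<lambda>n. infsum (f n) UNIV) \<longlonglongrightarrow> (\<Sum>\<^sub>\<infinity>k. g k * (1 / P * (1 / P)))"
  proof (rule tendsto_infsum_dominated)
    show "(\<lambda>n. f n k) \<longlonglongrightarrow> g k * (1 / P * (1 / P))" for k
      using rqfac_LIMSEQ[OF q(2), of k] rqfac_LIMSEQ[OF q(2), of "- k"] unfolding f_def P_def
      by (intro tendsto_mult tendsto_const) auto
    show "\<forall>\<^sub>F n in sequentially. \<forall>k\<in>UNIV. norm (f n k) \<le> h k * (B * B)"
      unfolding f_def norm_mult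
      by (intro always_eventually allI ballI mult_mono gh B mult_nonneg_nonneg B0)
         (auto intro: order_trans[OF norm_ge_zero gh])
    show "(\<lambda>k. h k * (B * B)) summable_on UNIV" by (rule summable_on_cmult_left[OF h])
  qed simp
  have eq: "infsum (f n) UNIV = 1 / ((\<Prod>i<Suc n. 1 - q ^ i * Y) * (\<Prod>i<n. 1 - q ^ i * (q / Y)))" for n
  proof (rule infsumI)
    define t where "t = Y / q ^ n"
    have t: "t \<noteq> 0" "\<And>k::int. q powi k * t \<noteq> 1"
      using q Y(1) Y(2)[of "k - int n" for k] by (auto simp: t_def power_int_diff)
    define c where "c = (\<lambda>k. (-1) powi k * q powi (choose2 (k + 1) - int n * k) * rqfac q k *
       rqfac q (int (2 * n) - k) / (1 - q powi k * t))"
    \<comment> \<open>The k-independent part of the recentred coefficient: C(k+n+1, 2) - n (k+n) is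
      C(k+1, 2) plus a constant.\<close>
    define W where "W = (-1) ^ n * q powi (choose2 (int n + 1) - int n * int n)"
    have W: "W \<noteq> 0" using q by (simp add: W_def)
    have "(c has_sum (t ^ n / (\<Prod>i<Suc (2 * n). 1 - q ^ i * t))) UNIV"
      unfolding c_def by (rule finite_partial_fractions[OF q t]) simp
    hence "((\<lambda>k. inverse W * c (k + int n)) has_sum
        (inverse W * (t ^ n / (\<Prod>i<Suc (2 * n). 1 - q ^ i * t)))) UNIV"
      by (intro has_sum_cmult_right) (simp add: has_sum_int_shift)
    moreover have "c (k + int n) = W * f n k" for k
    proof -
      have "2 * (choose2 (k + int n + 1) - int n * (k + int n)) =
            2 * (choose2 (k + 1) + (choose2 (int n + 1) - int n * int n))"
        by (simp only: choose2_double distrib_left right_diff_distrib) (simp add: algebra_simps)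
      hence "choose2 (k + int n + 1) - int n * (k + int n) =
             choose2 (k + 1) + (choose2 (int n + 1) - int n * int n)" by simp
      hence "q powi (choose2 (k + int n + 1) - int n * (k + int n)) =
             q powi choose2 (k + 1) * q powi (choose2 (int n + 1) - int n * int n)"
        using q by (simp add: power_int_add)
      moreover have "q powi (k + int n) * t = q powi k * Y"
        using q by (simp add: t_def power_int_add)
      moreover have "int (2 * n) - (k + int n) = int n - k" by simp
      ultimately show ?thesis
        unfolding c_def W_def f_def g_def by (simp add: power_int_add add.commute)
    qed
    moreover have "inverse W * (t ^ n / (\<Prod>i<Suc (2 * n). 1 - q ^ i * t)) =
        1 / ((\<Prod>i<Suc n. 1 - q ^ i * Y) * (\<Prod>i<n. 1 - q ^ i * (q / Y)))"
    proof -
      have "(\<Prod>i<Suc (2 * n). 1 - q ^ i * t) = (\<Prod>i<n + Suc n. 1 - q ^ i * t)"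
        by (simp add: mult_2)
      also have "\<dots> = (\<Prod>i<n. 1 - q ^ i * t) * (\<Prod>i<Suc n. 1 - q ^ (i + n) * t)"
        by (rule prod_lessThan_add)
      also have "(\<Prod>i<n. 1 - q ^ i * t) =
          (- Y) ^ n * q powi (- choose2 (int n + 1)) * (\<Prod>i<n. 1 - q ^ i * (q / Y))"
        using prod_reflect_split[of q "- Y" n] q Y by (simp add: t_def)
      also have "(\<Prod>i<Suc n. 1 - q ^ (i + n) * t) = (\<Prod>i<Suc n. 1 - q ^ i * Y)"
        by (rule prod.cong) (use q in \<open>auto simp: t_def power_add\<close>)
      finally have *: "(\<Prod>i<Suc (2 * n). 1 - q ^ i * t) = (- Y) ^ n * q powi (- choose2 (int n + 1)) *
         (\<Prod>i<n. 1 - q ^ i * (q / Y)) * (\<Prod>i<Suc n. 1 - q ^ i * Y)" .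
      have tn: "t ^ n = Y ^ n * q powi (- (int n * int n))"
        by (simp add: t_def power_divide power_int_minus power_int_mult field_simps)
      have "t ^ n = W * ((- Y) ^ n * q powi (- choose2 (int n + 1)))"
        unfolding tn W_def power_minus[of Y] using q
        by (simp add: power_int_diff power_int_minus field_simps flip: power_mult_distrib)
      moreover have "(- Y) ^ n * q powi (- choose2 (int n + 1)) \<noteq> 0" using q Y by simp
      moreover have "inverse w * (T / (U * B * A)) = 1 / (A * B)" if "T = w * U" "U \<noteq> 0" "w \<noteq> 0"
        for w T U A B :: complex using that by simp
      ultimately show ?thesis unfolding * using W by blast
    qed
    ultimately show "(f n has_sum (1 / ((\<Prod>i<Suc n. 1 - q ^ i * Y) * (\<Prod>i<n. 1 - q ^ i * (q / Y))))) UNIV"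
      using W by (simp flip: mult.assoc)
  qed
  have nz: "qpoch_inf Y q \<noteq> 0" "qpoch_inf (q / Y) q \<noteq> 0"
  proof -
    show "qpoch_inf Y q \<noteq> 0"
      using Y(2)[of "int i" for i] by (intro qpoch_inf_nz q) auto
    show "qpoch_inf (q / Y) q \<noteq> 0"
    proof (intro qpoch_inf_nz q)
      fix i show "q ^ i * (q / Y) \<noteq> 1"
        using Y(2)[of "- int (Suc i)"] Y(1) q
        by (auto simp: power_int_minus field_simps simp del: of_nat_Suc)
    qed
  qed
  have "(\<lambda>n. 1 / ((\<Prod>i<Suc n. 1 - q ^ i * Y) * (\<Prod>i<n. 1 - q ^ i * (q / Y))))
     \<longlonglongrightarrow> 1 / (qpoch_inf Y q * qpoch_inf (q / Y) q)"
    using nz by (intro tendsto_intros qpoch_inf_LIMSEQ q LIMSEQ_Suc[OF qpoch_inf_LIMSEQ]) auto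
  hence "(\<Sum>\<^sub>\<infinity>k. g k * (1 / P * (1 / P))) = 1 / (qpoch_inf Y q * qpoch_inf (q / Y) q)"
    using lim[unfolded eq] LIMSEQ_unique by blast
  hence "infsum g UNIV * (1 / P * (1 / P)) = 1 / (qpoch_inf Y q * qpoch_inf (q / Y) q)"
    by (simp only: infsum_cmult_left')
  hence "infsum g UNIV = P ^ 3 / jtheta Y q"
    using P nz by (simp add: jtheta_def P_def[symmetric] field_simps power3_eq_cube)
  thus ?thesis
    using has_sum_infsum[OF g] by (simp add: g_def P_def)
qed

section \<open>Kronecker's double sum\<close>

lemma summable_on_geometric_int:
  fixes a b :: real
  assumes "0 \<le> a" "a < 1" "1 < b"
  shows "(\<lambda>n::int. if n \<ge> 0 then a powi n else b powi n) summable_on UNIV"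
proof -
  have a: "(\<lambda>n. a ^ n) summable_on UNIV"
    using assms by (intro norm_summable_imp_summable_on) (simp add: power_abs summable_geometric)
  have "(\<lambda>n. inverse b * inverse b ^ n) summable_on UNIV"
    using assms by (intro norm_summable_imp_summable_on)
      (simp add: abs_mult power_abs summable_mult summable_geometric inverse_less_1_iff)
  moreover have "b powi (- int n - 1) = inverse b * inverse b ^ n" for n
    using assms by (simp add: power_int_diff power_int_minus power_inverse field_simps)
  ultimately have b: "(\<lambda>n. b powi (- int n - 1)) summable_on UNIV" by simp
  show ?thesis
    by (rule has_sum_imp_summable, rule has_sum_int_halves)
       (use has_sum_infsum[OF a] has_sum_infsum[OF b] in simp_all)
qed

text \<open>A case of Ramanujan's 1psi1 summation. Multiply by j(X;q) and rearrange the double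
  series: each inner sum is the expansion of 1/j(q^n Y;q), and by quasi-periodicity the outer sum is
  the theta series of j(XY;q). The second claim is absolute convergence.\<close>

lemma kronecker_single_sum:
  assumes q: "q \<noteq> 0" "norm q < 1" and X: "norm q < norm X" "norm X < 1"
    and Y: "Y \<noteq> 0" "\<And>k::int. q powi k * Y \<noteq> 1"
  shows "((\<lambda>s. X powi s / (1 - q powi s * Y)) has_sum
           (qpoch_inf q q ^ 3 * jtheta (X * Y) q / (jtheta X q * jtheta Y q))) UNIV"
    and "(\<lambda>s. norm X powi s / norm (1 - q powi s * Y)) summable_on UNIV"
proof -
  define P where "P = qpoch_inf q q"
  define g where "g = (\<lambda>s. X powi s / (1 - q powi s * Y))"
  have X0: "X \<noteq> 0" using X q by auto
  have jY: "jtheta Y q \<noteq> 0"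
  proof (rule jtheta_nz[OF q Y(1)])
    fix k :: int show "Y \<noteq> q powi k"
      using Y(2)[of "- k"] q by (auto simp: power_int_minus)
  qed
  have jX: "jtheta X q \<noteq> 0"
  proof (rule jtheta_nz[OF q X0])
    fix k :: int
    show "X \<noteq> q powi k"
    proof
      assume k: "X = q powi k"
      hence nX: "norm X = norm q powi k" by (simp add: norm_power_int)
      show False
      proof (cases "k \<ge> 1")
        case True
        hence "norm q powi k \<le> norm q powi 1" using q by (intro power_int_decreasing) auto
        thus False using X nX by simp
      next
        case False
        hence "norm q powi 0 \<le> norm q powi k" using q by (intro power_int_decreasing) auto
        thus False using X nX by simp
      qed
    qed
  qed
  obtain \<delta> where \<delta>: "\<delta> > 0" "\<And>k::int. \<delta> \<le> norm (1 - q powi k * Y)"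
    using one_minus_bounded_below_at[OF q Y] by blast
  have Yi: "inverse Y \<noteq> 0" "q powi k * inverse Y \<noteq> 1" for k :: int
    using Y(1) Y(2)[of "- k"] q by (auto simp: power_int_minus field_simps)
  obtain \<epsilon> where \<epsilon>: "\<epsilon> > 0" "\<And>k::int. \<epsilon> \<le> norm (1 - q powi k * inverse Y)"
    using one_minus_bounded_below_at[OF q Yi] by blast
  define h where "h = (\<lambda>s::int. (1 / \<delta> + 1 / (\<epsilon> * norm Y)) *
      (if s \<ge> 0 then norm X powi s else (norm X / norm q) powi s))"
  have gh: "norm (g s) \<le> h s" for s
  proof (cases "s \<ge> 0")
    case True
    have "norm (g s) \<le> norm X powi s / \<delta>"
      unfolding g_def norm_divide norm_power_int using \<delta>(1) Y(2)[of s]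
      by (intro divide_left_mono mult_pos_pos \<delta>(2)) simp_all
    also have "\<dots> \<le> (1 / \<delta> + 1 / (\<epsilon> * norm Y)) * norm X powi s"
      using \<delta> \<epsilon> by (simp add: algebra_simps)
    finally show ?thesis using True by (simp add: h_def)
  next
    case False
    \<comment> \<open>For negative \<open>s\<close> the denominator is rewritten through 1 -
      q^(-s)/Y, which stays away from 0. What remains is a power of X/q, of modulus greater than 1,
      so the terms decay as s tends to -infinity.\<close>
    have "1 - z * Y = - (z * Y) * (1 - inverse z * inverse Y)" if "z \<noteq> 0" for z
      using that Y(1) by (simp add: field_simps)
    from this[of "q powi s"]
    have "1 - q powi s * Y = - (q powi s * Y) * (1 - q powi (- s) * inverse Y)"
      using q by (simp add: power_int_minus)
    hence "norm (g s) = (norm X / norm q) powi s / (norm Y * norm (1 - q powi (- s) * inverse Y))"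
      using q by (simp add: g_def norm_divide norm_mult norm_power_int power_int_divide_distrib)
    also have "\<dots> \<le> (norm X / norm q) powi s / (norm Y * \<epsilon>)"
      using \<epsilon>(1) Y(1) Yi(2)[of "- s"]
      by (intro divide_left_mono mult_left_mono mult_pos_pos \<epsilon>(2)) simp_all
    also have "\<dots> \<le> (1 / \<delta> + 1 / (\<epsilon> * norm Y)) * (norm X / norm q) powi s"
      using \<delta> \<epsilon> by (simp add: algebra_simps)
    finally show ?thesis using False by (simp add: h_def)
  qed
  have "h summable_on UNIV"
    unfolding h_def using X q by (intro summable_on_cmult_right summable_on_geometric_int) auto
  hence ng: "(\<lambda>s. norm (g s)) summable_on UNIV"
    by (rule Infinite_Sum.abs_summable_on_comparison_test'[OF _ gh])
  thus "(\<lambda>s. norm X powi s / norm (1 - q powi s * Y)) summable_on UNIV"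
    by (simp add: g_def norm_divide norm_power_int)
  define L where "L = infsum g UNIV"
  have g: "(g has_sum L) UNIV"
    unfolding L_def by (rule has_sum_infsum[OF abs_summable_summable[OF ng]])
  have "((\<lambda>(m, s). (q powi choose2 m * (- X) powi m) * g s) has_sum (jtheta X q * L)) (UNIV \<times> UNIV)"
    by (rule has_sum_times[OF jtheta_has_sum[OF q X0] g])
  \<comment> \<open>The substitution n = m + s, k = -m, under which the sum over k at fixed n is a
    partial fraction series.\<close>
  also have "?this \<longleftrightarrow> ((\<lambda>(n, k). q powi choose2 (- k) * (- X) powi (- k) * g (n + k)) has_sum (jtheta X q * L)) (UNIV \<times> UNIV)"
    by (rule has_sum_reindex_bij_witness[of _ "\<lambda>(n, k). (- k, n + k)" "\<lambda>(m, s). (s + m, - m)"]) auto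
  finally have "((\<lambda>n. (P ^ 3 / jtheta Y q) * (q powi choose2 n * (- (X * Y)) powi n)) has_sum (jtheta X q * L)) UNIV"
  proof (rule has_sum_SigmaD)
    fix n :: int
    have qn: "q powi n * Y \<noteq> 0" "q powi k * (q powi n * Y) \<noteq> 1" for k
      using q Y(1) Y(2)[of "k + n"] by (auto simp: power_int_add mult.assoc)
    have "((\<lambda>k. X powi n * ((-1) powi k * q powi choose2 (k + 1) / (1 - q powi k * (q powi n * Y)))) has_sum
       (X powi n * (P ^ 3 / jtheta (q powi n * Y) q))) UNIV"
      unfolding P_def by (intro has_sum_cmult_right reciprocal_jtheta_has_sum q qn)
    moreover have "X powi n * ((-1) powi k * q powi choose2 (k + 1) / (1 - q powi k * (q powi n * Y))) =
       q powi choose2 (- k) * (- X) powi (- k) * g (n + k)" for k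
    proof -
      have "2 * choose2 (- k) = 2 * choose2 (k + 1)"
        by (simp only: choose2_double) (simp add: algebra_simps)
      hence "choose2 (- k) = choose2 (k + 1)" by simp
      moreover have "(- X) powi (- k) = (-1) powi k * X powi (- k)"
        by (simp add: power_int_minus_left)
      moreover have "xn * (sg * c / (1 - qk * (qn * Y))) = c * (sg * inverse xk) * ((xn * xk) / (1 - (qn * qk) * Y))"
        if "xk \<noteq> 0" for xn xk sg c qk qn :: complex
        using that by (simp add: mult_ac)
      ultimately show ?thesis
        using q X0 by (simp add: g_def power_int_add power_int_minus)
    qed
    moreover have "X powi n * (P ^ 3 / jtheta (q powi n * Y) q) =
      (P ^ 3 / jtheta Y q) * (q powi choose2 n * (- (X * Y)) powi n)"
    proof -
      have "(- (X * Y)) powi n = X powi n * (- Y) powi n"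
        by (metis mult_minus_right power_int_mult_distrib)
      moreover have "xn * (p / (inverse c * inverse yn * j)) = p / j * (c * (xn * yn))" if "c \<noteq> 0" "yn \<noteq> 0"
        for xn p c yn j :: complex
        using that by (simp add: field_simps)
      ultimately show ?thesis
        using q Y(1) by (simp add: jtheta_shift power_int_minus)
    qed
    ultimately show "((\<lambda>k. case (n, k) of (n, k) \<Rightarrow> q powi choose2 (- k) * (- X) powi (- k) * g (n + k)) has_sum
        (P ^ 3 / jtheta Y q) * (q powi choose2 n * (- (X * Y)) powi n)) UNIV"
      by simp
  qed
  moreover have "((\<lambda>n. (P ^ 3 / jtheta Y q) * (q powi choose2 n * (- (X * Y)) powi n)) has_sum
       ((P ^ 3 / jtheta Y q) * jtheta (X * Y) q)) UNIV"
    by (intro has_sum_cmult_right jtheta_has_sum q) (use X0 Y in auto)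
  ultimately have "jtheta X q * L = (P ^ 3 / jtheta Y q) * jtheta (X * Y) q"
    by (rule has_sum_unique)
  hence "L = P ^ 3 * jtheta (X * Y) q / (jtheta X q * jtheta Y q)"
    using jX jY by (simp add: field_simps)
  with g show "((\<lambda>s. X powi s / (1 - q powi s * Y)) has_sum
           (qpoch_inf q q ^ 3 * jtheta (X * Y) q / (jtheta X q * jtheta Y q))) UNIV"
    by (simp add: g_def P_def)
qed

text \<open>\<open>sw P R\<close> is the mean of the signs of \<open>P\<close> and \<open>R\<close>, which is why \<open>sw_combine\<close> holds.\<close>

definition sw :: "bool \<Rightarrow> bool \<Rightarrow> complex" where
  "sw P R = (if P \<and> R then 1 else if \<not> P \<and> \<not> R then -1 else 0)"

lemma sw_combine: "sw P R = sw P J + sw R I - sw I J"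
  by (auto simp: sw_def)

lemma norm_sw_le: "norm (sw P R) \<le> 1"
  by (auto simp: sw_def)

text \<open>The same fraction has two expansions: nonnegative powers for |z| < 1, and negative
  powers with a minus sign for |z| > 1. The weight \<open>sw\<close> selects the convergent
  one.\<close>

lemma geometric_has_sum_int:
  assumes "z \<noteq> 0" "norm z \<noteq> 1"
  shows "((\<lambda>t. sw (norm z < 1) (t \<ge> 0) * z powi t) has_sum (1 / (1 - z))) UNIV"
    and "((\<lambda>t. norm (sw (norm z < 1) (t \<ge> 0) * z powi t)) has_sum (1 / \<bar>1 - norm z\<bar>)) UNIV"
proof -
  have nonneg: "((\<lambda>n. w ^ n) has_sum (1 / (1 - w))) UNIV" if "norm w < 1"
    for w :: "'a::{real_normed_field, banach}"
    using that geometric_sums[OF that]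
    by (intro norm_summable_imp_has_sum) (simp_all add: norm_power summable_geometric)
  have neg: "((\<lambda>n. w powi (- int n - 1)) has_sum (1 / (w - 1))) UNIV" if "norm w > 1"
    for w :: "'a::{real_normed_field, banach}"
  proof -
    have w0: "w \<noteq> 0" "w \<noteq> 1" using that by auto
    have "norm (inverse w) < 1" using that by (simp add: norm_inverse inverse_less_1_iff)
    hence "((\<lambda>n. inverse w * inverse w ^ n) has_sum (inverse w * (1 / (1 - inverse w)))) UNIV"
      by (intro has_sum_cmult_right nonneg)
    moreover have "inverse w * (1 / (1 - inverse w)) = 1 / (w - 1)"
      using w0 by (simp add: field_simps)
    moreover have "inverse w * inverse w ^ n = w powi (- int n - 1)" for n
      using w0 by (simp add: power_int_diff power_int_minus power_inverse field_simps)
    ultimately show ?thesis by simp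
  qed
  show "((\<lambda>t. sw (norm z < 1) (t \<ge> 0) * z powi t) has_sum (1 / (1 - z))) UNIV"
  proof (cases "norm z < 1")
    case True
    show ?thesis
      using has_sum_int_halves[of "\<lambda>t. sw (norm z < 1) (t \<ge> 0) * z powi t" "1 / (1 - z)" 0] nonneg[OF True] True
      by (simp add: sw_def)
  next
    case False
    hence z: "norm z > 1" using assms by auto
    hence "z \<noteq> 1" by auto
    hence "- (1 / (z - 1)) = 1 / (1 - z)" by (simp add: field_simps)
    thus ?thesis
      using has_sum_int_halves[of "\<lambda>t. sw (norm z < 1) (t \<ge> 0) * z powi t" 0 "- (1 / (z - 1))"]
        has_sum_uminusI[OF neg[OF z]] z
      by (simp add: sw_def)
  qed
  show "((\<lambda>t. norm (sw (norm z < 1) (t \<ge> 0) * z powi t)) has_sum (1 / \<bar>1 - norm z\<bar>)) UNIV"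
  proof (cases "norm z < 1")
    case True
    show ?thesis
      using has_sum_int_halves[of "\<lambda>t. norm (sw (norm z < 1) (t \<ge> 0) * z powi t)" "1 / (1 - norm z)" 0]
        nonneg[of "norm z"] True
      by (simp add: sw_def norm_mult norm_power_int norm_power)
  next
    case False
    hence z: "norm z > 1" using assms by auto
    thus ?thesis
      using has_sum_int_halves[of "\<lambda>t. norm (sw (norm z < 1) (t \<ge> 0) * z powi t)" 0 "1 / (norm z - 1)"]
        neg[of "norm z"] z
      by (simp add: sw_def norm_mult norm_power_int)
  qed
qed

text \<open>The inner sum of absolute values is |c| / |1 - |z||, so \<open>abs\<close> makes the
  double family absolutely summable.\<close>

lemma has_sum_geometric_expansion:
  fixes c z :: "'a \<Rightarrow> complex"
  assumes z: "\<And>r. z r \<noteq> 0" "\<And>r. norm (z r) \<noteq> 1"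
    and sum: "((\<lambda>r. c r / (1 - z r)) has_sum S) UNIV"
    and abs: "(\<lambda>r. norm (c r) / \<bar>1 - norm (z r)\<bar>) summable_on UNIV"
  shows "((\<lambda>(r, t). sw (norm (z r) < 1) (t \<ge> 0) * (c r * z r powi t)) has_sum S) (UNIV \<times> UNIV)"
proof (rule has_sum_SigmaI[OF _ sum])
  show "((\<lambda>t. case (r, t) of (r, t) \<Rightarrow> sw (norm (z r) < 1) (t \<ge> 0) * (c r * z r powi t)) has_sum (c r / (1 - z r))) UNIV" for r
    using has_sum_cmult_right[OF geometric_has_sum_int(1)[OF z], of "c r" r] by (simp add: mult_ac)
  have "(\<lambda>p. norm (case p of (r, t) \<Rightarrow> sw (norm (z r) < 1) (t \<ge> 0) * (c r * z r powi t))) summable_on (UNIV \<times> UNIV)"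
  proof (rule summable_on_SigmaI[OF _ abs])
    show "((\<lambda>t. norm (case (r, t) of (r, t) \<Rightarrow> sw (norm (z r) < 1) (t \<ge> 0) * (c r * z r powi t))) has_sum
        (norm (c r) / \<bar>1 - norm (z r)\<bar>)) UNIV" for r
      using has_sum_cmult_right[OF geometric_has_sum_int(2)[OF z], of "norm (c r)" r]
      by (simp add: norm_mult mult_ac)
  qed auto
  thus "(\<lambda>(r, t). sw (norm (z r) < 1) (t \<ge> 0) * (c r * z r powi t)) summable_on UNIV \<times> UNIV"
    by (rule abs_summable_summable)
qed

text \<open>The bound for 1 - q^k Y applied to the positive reals \<open>norm q\<close> and
  \<open>norm Y\<close>, viewed as complex numbers.\<close>

lemma one_minus_norm_bounded_below:
  fixes q Y :: complex
  assumes q: "q \<noteq> 0" "norm q < 1" and Y: "Y \<noteq> 0" "\<And>k::int. norm (q powi k * Y) \<noteq> 1"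
  obtains \<delta> where "\<delta> > 0" "\<And>k::int. \<delta> \<le> \<bar>1 - norm (q powi k * Y)\<bar>"
proof -
  have eq: "of_real (norm q) powi k * of_real (norm Y) = (of_real (norm (q powi k * Y)) :: complex)" for k
    by (simp add: norm_mult norm_power_int)
  have "of_real (norm q) powi k * of_real (norm Y) \<noteq> (1 :: complex)" for k
    unfolding eq using Y(2)[of k] by (metis of_real_eq_1_iff)
  then obtain \<delta> where \<delta>: "\<delta> > 0"
      "\<And>k::int. \<delta> \<le> norm (1 - of_real (norm q) powi k * (of_real (norm Y) :: complex))"
    using one_minus_bounded_below_at[of "of_real (norm q)" "of_real (norm Y)"] q Y(1) by auto
  have "norm (1 - of_real z :: complex) = \<bar>1 - z\<bar>" for z
    by (metis norm_of_real of_real_1 of_real_diff)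
  hence "\<delta> \<le> \<bar>1 - norm (q powi k * Y)\<bar>" for k
    using \<delta>(2)[of k] unfolding eq by simp
  with \<delta>(1) show ?thesis by (rule that)
qed

lemma appell_sum_expansion:
  assumes q: "q \<noteq> 0" "norm q < 1" and Y: "Y \<noteq> 0" "\<And>k::int. norm (q powi k * Y) \<noteq> 1"
  shows "((\<lambda>(r, t). sw (norm (q powi r * Y) < 1) (t \<ge> 0) * (q powi choose2 r * (q powi r * Y) powi t))
     has_sum (\<Sum>\<^sub>\<infinity>r. q powi choose2 r / (1 - q powi r * Y))) (UNIV \<times> UNIV)"
proof (rule has_sum_geometric_expansion)
  have ne1: "q powi k * Y \<noteq> 1" for k using Y(2)[of k] by (metis norm_one)
  obtain \<delta> where \<delta>: "\<delta> > 0" "\<And>k::int. \<delta> \<le> \<bar>1 - norm (q powi k * Y)\<bar>"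
    using one_minus_norm_bounded_below[OF q Y] by blast
  have g: "(\<lambda>k. norm (q powi choose2 k) / \<delta>) summable_on UNIV"
    using summable_on_cmult_left[OF summable_on_gauss[OF q, of 1], of "inverse \<delta>"]
    by (simp add: divide_inverse)
  show *: "(\<lambda>r. norm (q powi choose2 r) / \<bar>1 - norm (q powi r * Y)\<bar>) summable_on UNIV"
    using \<delta>(1) Y(2)
    by (intro summable_on_comparison_test[OF g] divide_left_mono mult_pos_pos \<delta>(2)) simp_all
  have "norm (q powi choose2 r / (1 - q powi r * Y)) \<le> norm (q powi choose2 r) / \<bar>1 - norm (q powi r * Y)\<bar>" for r
  proof -
    have "\<bar>norm (1::complex) - norm (q powi r * Y)\<bar> \<le> norm (1 - q powi r * Y)"
      by (rule norm_triangle_ineq3)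
    thus ?thesis unfolding norm_divide using ne1[of r] Y(2)[of r]
      by (intro divide_left_mono mult_pos_pos) auto
  qed
  hence "(\<lambda>r. q powi choose2 r / (1 - q powi r * Y)) summable_on UNIV"
    by (rule abs_summable_summable[OF Infinite_Sum.abs_summable_on_comparison_test'[OF *]])
  thus "((\<lambda>r. q powi choose2 r / (1 - q powi r * Y)) has_sum
      (\<Sum>\<^sub>\<infinity>r. q powi choose2 r / (1 - q powi r * Y))) UNIV"
    by (rule has_sum_infsum)
qed (use q Y in auto)

text \<open>Translates the sign of \<open>t\<close> into a condition on the size of q^t X. In that
  form the weights behave well when X is multiplied by a power of q.\<close>

lemma powi_less_one_iff:
  fixes q X :: complex
  assumes q: "q \<noteq> 0" "norm q < 1" and X: "norm q < norm X" "norm X < 1"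
  shows "norm (q powi t * X) < 1 \<longleftrightarrow> t \<ge> 0" and "norm (q powi t * X) \<noteq> 1"
proof -
  have "norm (q powi t * X) < 1" if "t \<ge> 0"
  proof -
    have "norm (q powi t * X) \<le> 1 * norm X"
      unfolding norm_mult norm_power_int using q that by (intro mult_right_mono power_int_le_one) auto
    thus ?thesis using X by simp
  qed
  moreover have "norm (q powi t * X) > 1" if "t < 0"
  proof -
    have "norm q powi (-1) \<le> norm q powi t"
      using q that by (intro power_int_decreasing) auto
    hence "inverse (norm q) \<le> norm q powi t" by (simp add: power_int_minus)
    hence "inverse (norm q) * norm X \<le> norm (q powi t * X)"
      unfolding norm_mult norm_power_int by (intro mult_right_mono) auto
    moreover have "1 < inverse (norm q) * norm X" using X q by (simp add: field_simps)
    ultimately show ?thesis by linarith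
  qed
  ultimately show "norm (q powi t * X) < 1 \<longleftrightarrow> t \<ge> 0" "norm (q powi t * X) \<noteq> 1"
    by (force, metis less_irrefl not_le)
qed

text \<open>The floor gives |q|^(n+1) < |X| \<le> |q|^n, and the hypothesis on the norms excludes
  equality.\<close>

lemma ex_powi_annulus:
  fixes q X :: complex
  assumes q: "q \<noteq> 0" "norm q < 1" and X: "X \<noteq> 0" "\<And>k::int. norm (q powi k * X) \<noteq> 1"
  obtains n X' where "X = q powi n * X'" "norm q < norm X'" "norm X' < 1"
proof -
  define n where "n = \<lfloor>ln (norm X) / ln (norm q)\<rfloor>"
  have lq: "ln (norm q) < 0" using q by simp
  have pw: "norm q powi k = exp (of_int k * ln (norm q))" for k :: int
    using q by (simp flip: exp_power_int)
  have "of_int n * ln (norm q) \<ge> ln (norm X)" "ln (norm X) > of_int (n + 1) * ln (norm q)"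
    using lq floor_correct[of "ln (norm X) / ln (norm q)"]
    unfolding n_def[symmetric] by (simp_all add: le_divide_eq divide_less_eq)
  hence "exp (ln (norm X)) \<le> exp (of_int n * ln (norm q))"
        "exp (of_int (n + 1) * ln (norm q)) < exp (ln (norm X))"
    by (simp_all only: exp_le_cancel_iff exp_less_cancel_iff)
  hence "norm X \<le> norm q powi n" "norm q powi n * norm q < norm X"
    using X(1) q unfolding pw[symmetric] by (simp_all add: power_int_add)
  moreover have "norm X \<noteq> norm q powi n"
    using X(2)[of "- n"] q by (auto simp: norm_mult norm_power_int power_int_minus norm_inverse)
  moreover have "norm q powi n > 0" using q by simp
  moreover have nX: "norm (q powi (- n) * X) = norm X / norm q powi n"
    by (simp add: norm_mult norm_power_int power_int_minus norm_inverse divide_inverse)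
  ultimately have "norm q < norm (q powi (- n) * X)" "norm (q powi (- n) * X) < 1"
    unfolding nX by (simp_all add: pos_less_divide_eq pos_divide_less_eq mult.commute)
  moreover have "X = q powi n * (q powi (- n) * X)"
    using q by (simp add: power_int_minus)
  ultimately show ?thesis using that by blast
qed

text \<open>Move X into the annulus by X = q^n X', where the single sum converges, and expand 1/(1 -
  q^s Y). Shifting \<open>t\<close> by \<open>n\<close> restores X at the cost of Y^(-n), the same
  factor that quasi-periodicity gives for the theta quotient.\<close>

theorem kronecker_double_sum:
  assumes q: "q \<noteq> 0" "norm q < 1" and X: "X \<noteq> 0" "\<And>k::int. norm (q powi k * X) \<noteq> 1"
    and Y: "Y \<noteq> 0" "\<And>k::int. norm (q powi k * Y) \<noteq> 1"
  shows "((\<lambda>(s, t). sw (norm (q powi s * Y) < 1) (norm (q powi t * X) < 1) *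
            (q powi (s * t) * X powi s * Y powi t))
     has_sum (qpoch_inf q q ^ 3 * jtheta (X * Y) q / (jtheta X q * jtheta Y q))) (UNIV \<times> UNIV)"
proof -
  obtain n X' where X': "X = q powi n * X'" "norm q < norm X'" "norm X' < 1"
    using ex_powi_annulus[OF q X] by blast
  have X'0: "X' \<noteq> 0" using X' q by auto
  have ne1: "q powi k * Y \<noteq> 1" for k using Y(2)[of k] by (metis norm_one)
  define L where "L = qpoch_inf q q ^ 3 * jtheta (X' * Y) q / (jtheta X' q * jtheta Y q)"
  have L: "((\<lambda>s. X' powi s / (1 - q powi s * Y)) has_sum L) UNIV"
    unfolding L_def by (rule kronecker_single_sum[OF q X'(2,3) Y(1) ne1])
  \<comment> \<open>The expansion has |1 - |q^s Y|| in the denominator, hence absolute convergence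
    is taken for |q| and |Y| in place of \<open>q\<close> and \<open>Y\<close>.\<close>
  have abs: "(\<lambda>s. norm (X' powi s) / \<bar>1 - norm (q powi s * Y)\<bar>) summable_on UNIV"
  proof -
    have eq: "of_real (norm q) powi k * of_real (norm Y) = (of_real (norm (q powi k * Y)) :: complex)" for k
      by (simp add: norm_mult norm_power_int)
    have ne: "of_real (norm q) powi k * of_real (norm Y) \<noteq> (1 :: complex)" for k
      unfolding eq using Y(2)[of k] by (metis of_real_eq_1_iff)
    have "norm (1 - of_real z :: complex) = \<bar>1 - z\<bar>" for z
      by (metis norm_of_real of_real_1 of_real_diff)
    thus ?thesis
      using kronecker_single_sum(2)[of "of_real (norm q)" X' "of_real (norm Y)"] ne q X' Y(1)
      unfolding eq by (simp add: norm_power_int)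
  qed
  have "((\<lambda>(s, t). sw (norm (q powi s * Y) < 1) (t \<ge> 0) * (X' powi s * (q powi s * Y) powi t))
      has_sum L) (UNIV \<times> UNIV)"
    by (rule has_sum_geometric_expansion[OF _ _ L abs]) (use q Y in auto)
  hence "((\<lambda>p. Y powi (- n) * (case p of (s, t) \<Rightarrow> sw (norm (q powi s * Y) < 1) (t \<ge> 0) * (X' powi s * (q powi s * Y) powi t)))
      has_sum (Y powi (- n) * L)) (UNIV \<times> UNIV)"
    by (rule has_sum_cmult_right)
  also have "?this \<longleftrightarrow> ((\<lambda>(s, t). sw (norm (q powi s * Y) < 1) (norm (q powi t * X) < 1) *
            (q powi (s * t) * X powi s * Y powi t))
     has_sum (Y powi (- n) * L)) (UNIV \<times> UNIV)"
  proof (rule has_sum_reindex_bij_witness[of _ "\<lambda>(s, t). (s, t + n)" "\<lambda>(s, t). (s, t - n)"], goal_cases)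
    case (5 p)
    obtain s t where p: "p = (s, t)" by force
    have "q powi (t - n) * X = q powi t * X'"
      using q by (simp add: X' power_int_diff)
    hence "norm (q powi (t - n) * X) < 1 \<longleftrightarrow> t \<ge> 0"
      using powi_less_one_iff[OF q X'(2,3), of t] by simp
    moreover have "q powi (s * (t - n)) * X powi s * Y powi (t - n) =
        Y powi (- n) * (X' powi s * (q powi s * Y) powi t)"
    proof -
      have "q powi (s * (t - n)) * (q powi n) powi s = (q powi s) powi t"
        using q by (simp add: power_int_mult[symmetric] power_int_add[symmetric] algebra_simps)
      moreover have "Y powi (t - n) = Y powi (- n) * Y powi t"
        using Y(1) by (simp add: power_int_add[symmetric])
      ultimately show ?thesis
        by (simp add: X' power_int_mult_distrib mult_ac)
    qed
    ultimately show ?case by (simp add: p mult_ac)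
  qed auto
  also have "Y powi (- n) * L = qpoch_inf q q ^ 3 * jtheta (X * Y) q / (jtheta X q * jtheta Y q)"
  proof -
    have 1: "jtheta X q = q powi (- choose2 n) * (- X') powi (- n) * jtheta X' q"
      unfolding X'(1) by (rule jtheta_shift[OF q X'0])
    have "jtheta (X * Y) q = jtheta (q powi n * (X' * Y)) q" by (simp add: X' mult.assoc)
    also have "\<dots> = q powi (- choose2 n) * (- (X' * Y)) powi (- n) * jtheta (X' * Y) q"
      by (rule jtheta_shift) (use q X'0 Y in auto)
    also have "(- (X' * Y)) powi (- n) = (- X') powi (- n) * Y powi (- n)"
      by (metis mult_minus_left power_int_mult_distrib)
    finally have 2: "jtheta (X * Y) q = q powi (- choose2 n) * ((- X') powi (- n) * Y powi (- n)) * jtheta (X' * Y) q" .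
    show ?thesis unfolding L_def 1 2 using q X'0 by simp
  qed
  finally show ?thesis .
qed

section \<open>The fourfold sums\<close>

text \<open>The quotients of b are parameters tied by equations, so exponents are free of integer
  division. The assumptions are symmetric under exchanging (a, \<alpha>, u) with (c, \<gamma>,
  v).\<close>

locale hecke_form =
  fixes a b c \<alpha> \<gamma> D :: int and q u v :: complex
  assumes pos: "a > 0" "c > 0" "\<alpha> > 0" "\<gamma> > 0" and D_pos: "D > 0"
    and b_a: "b = a * \<alpha>" and b_c: "b = c * \<gamma>" and D_eq: "D = \<alpha> * \<gamma> - 1"
    and q: "q \<noteq> 0" "norm q < 1" and uv: "u \<noteq> 0" "v \<noteq> 0"
begin

text \<open>Bookkeeping device: an equality of products of powers reduces to three equalities of
  integer exponents.\<close>

definition mono :: "int \<Rightarrow> int \<Rightarrow> int \<Rightarrow> complex" where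
  "mono e i j = q powi e * u powi i * v powi j"

lemma mono_mult: "mono e i j * mono e' i' j' = mono (e + e') (i + i') (j + j')"
  using q uv by (simp add: mono_def power_int_add)

lemma mono_powi: "mono e i j powi n = mono (e * n) (i * n) (j * n)"
  by (simp add: mono_def power_int_mult_distrib power_int_mult)

lemma mono_nz: "mono e i j \<noteq> 0"
  using q uv by (simp add: mono_def)

lemma q_mono: "q powi e = mono e 0 0" and u_mono: "u powi i = mono 0 i 0" and v_mono: "v powi j = mono 0 0 j"
  by (simp_all add: mono_def)

lemma q_powi: "e > 0 \<Longrightarrow> q powi e \<noteq> 0 \<and> norm (q powi e) < 1"
  using q by (simp add: power_int_nonneg_exp norm_power power_less_one_iff)

definition Q1 where "Q1 = q powi (c * D)"
definition Q0 where "Q0 = q powi (a * D)"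
definition Q where "Q = q powi (b * D)"
text \<open>\<open>Q1 * Y0\<close> and \<open>Q0 * X0\<close> are the products of the first
  arguments of the two Appell-Lerch sums with z = -1. The theta denominators are j(Q1^d Y0; Q) and
  j(Q0^(e+1) X0; Q).\<close>

definition Y0 where "Y0 = mono (- (a * choose2 \<alpha>)) (- \<alpha>) 1"
definition X0 where "X0 = mono (- (c * choose2 \<gamma>)) 1 (- \<gamma>)"
definition T where
  "T i j k m = mono (a * choose2 i + b * i * j + c * choose2 j + c * D * choose2 k + a * D * choose2 m) i j"
definition A1 where "A1 = (\<Sum>\<^sub>\<infinity>r. Q1 powi choose2 r / (1 - Q1 powi r * Y0))"
definition A0 where "A0 = (\<Sum>\<^sub>\<infinity>r. Q0 powi choose2 r / (1 - Q0 powi r * X0))"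

lemma b_pos: "b > 0" using pos b_a by simp

lemma Q1: "Q1 \<noteq> 0" "norm Q1 < 1" and Q0: "Q0 \<noteq> 0" "norm Q0 < 1" and Q: "Q \<noteq> 0" "norm Q < 1"
  using q_powi pos b_pos D_pos by (simp_all add: Q1_def Q0_def Q_def)

lemma cD: "c * D = a * \<alpha> * \<alpha> - c" and aD: "a * D = c * \<gamma> * \<gamma> - a"
proof -
  have "a * \<alpha> = c * \<gamma>" using b_a b_c by simp
  hence "c * (\<alpha> * \<gamma>) = a * \<alpha> * \<alpha>" "a * (\<alpha> * \<gamma>) = c * \<gamma> * \<gamma>"
    by (simp_all add: mult.commute mult.left_commute)
  thus "c * D = a * \<alpha> * \<alpha> - c" "a * D = c * \<gamma> * \<gamma> - a"
    by (simp_all add: D_eq right_diff_distrib)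
qed

text \<open>Expand the Appell sum geometrically and substitute i = n - \<alpha> t, j = t, k = r + t,
  where n indexes the series of j(-u; q^a); the weight then depends on r = k - j and t = j.\<close>

lemma term1_has_sum:
  assumes Y: "\<And>k::int. norm (Q1 powi k * Y0) \<noteq> 1"
  shows "((\<lambda>(i, j, k, m). sw (norm (Q1 powi (k - j) * Y0) < 1) (j \<ge> 0) * T i j k m)
     has_sum (jtheta (- u) (q powi a) * (A1 * jtheta (-1) Q0))) UNIV"
proof -
  have Y0: "Y0 \<noteq> 0" by (simp add: Y0_def mono_nz)
  have qa: "q powi a \<noteq> 0" "norm (q powi a) < 1" using q_powi pos by auto
  have "((\<lambda>(n, ((r, t), m)). ((q powi a) powi choose2 n * u powi n) *
     ((sw (norm (Q1 powi r * Y0) < 1) (t \<ge> 0) * (Q1 powi choose2 r * (Q1 powi r * Y0) powi t)) * Q0 powi choose2 m))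
     has_sum (jtheta (- u) (q powi a) * (A1 * jtheta (-1) Q0))) (UNIV \<times> (UNIV \<times> UNIV) \<times> UNIV)"
    using has_sum_times[OF jacobi_triple_product[OF qa uv(1)]
        has_sum_times[OF appell_sum_expansion[OF Q1 Y0 Y] theta_one_has_sum[OF Q0]]]
    by (simp add: A1_def case_prod_unfold)
  also have "?this \<longleftrightarrow> ?thesis"
  proof (rule has_sum_reindex_bij_witness[of _ "\<lambda>(i, j, k, m). (i + \<alpha> * j, ((k - j, j), m))"
        "\<lambda>(n, ((r, t), m)). (n - \<alpha> * t, t, r + t, m)"], goal_cases)
    case (5 p)
    obtain n r t m where p: "p = (n, ((r, t), m))" by (metis surj_pair)
    \<comment> \<open>Doubling clears the halves of the binomials and leaves a polynomial
      identity.\<close>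
    have "2 * (a * choose2 (n - \<alpha> * t) + b * (n - \<alpha> * t) * t + c * choose2 t + c * D * choose2 (r + t)) =
        2 * (a * choose2 n + c * D * choose2 r + (c * D * r - a * choose2 \<alpha>) * t)"
    proof -
      have d: "2 * (w * choose2 z) = w * (z * (z - 1))" for w z
        using choose2_double[of z] by (simp add: mult.left_commute)
      have d': "2 * ((w - e * choose2 z) * t) = 2 * w * t - e * (z * (z - 1)) * t" for w z e
      proof -
        have "2 * ((w - e * choose2 z) * t) = 2 * w * t - (2 * (e * choose2 z)) * t"
          by (simp add: algebra_simps)
        thus ?thesis by (simp only: d)
      qed
      show ?thesis
        by (simp only: distrib_left d d' cD b_a) (simp add: algebra_simps)
    qed
    hence E: "a * choose2 (n - \<alpha> * t) + b * (n - \<alpha> * t) * t + c * choose2 t + c * D * choose2 (r + t)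
       = a * choose2 n + c * D * choose2 r + (c * D * r - a * choose2 \<alpha>) * t" by simp
    have "T (n - \<alpha> * t) t (r + t) m = (q powi a) powi choose2 n * u powi n *
       (Q1 powi choose2 r * (Q1 powi r * Y0) powi t * Q0 powi choose2 m)"
      unfolding T_def E Q1_def Q0_def Y0_def q_mono u_mono mono_mult mono_powi
      by (rule arg_cong3[where f = mono]) (simp_all add: algebra_simps)
    thus ?case by (simp add: p mult_ac)
  qed auto
  finally show ?thesis .
qed

text \<open>The weight vanishes unless i and j lie on the same side of 0; there ij \<ge> 0 and
  |q^(bij)| \<le> 1, so a product of two theta series dominates. The signs (-1)^(r+s) disappear on
  passing to \<open>u\<close> and \<open>v\<close>.\<close>

lemma hecke_has_sum:
  "((\<lambda>(i, j). sw (i \<ge> 0) (j \<ge> 0) * mono (a * choose2 i + b * i * j + c * choose2 j) i j)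
     has_sum hecke_f a b c (- u) (- v) q) UNIV"
proof -
  have qa: "q powi a \<noteq> 0" "norm (q powi a) < 1" and qc: "q powi c \<noteq> 0" "norm (q powi c) < 1"
    using q_powi pos by auto
  let ?g = "\<lambda>(i, j). ((q powi a) powi choose2 i * u powi i) * ((q powi c) powi choose2 j * v powi j)"
  let ?f = "\<lambda>(i, j). sw (i \<ge> 0) (j \<ge> 0) * mono (a * choose2 i + b * i * j + c * choose2 j) i j"
  have "?g summable_on UNIV"
    using has_sum_imp_summable[OF has_sum_times[OF jacobi_triple_product[OF qa uv(1)] jacobi_triple_product[OF qc uv(2)]]]
    by simp
  hence g: "(\<lambda>p. norm (?g p)) summable_on UNIV"
    by (simp add: summable_on_iff_abs_summable_on_complex)
  have fg: "norm (?f p) \<le> norm (?g p)" for p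
  proof -
    obtain i j where p: "p = (i, j)" by force
    have eq: "mono (a * choose2 i + b * i * j + c * choose2 j) i j = q powi (b * (i * j)) * ?g p"
      by (simp add: p q_mono u_mono v_mono mono_mult mono_powi algebra_simps)
    show ?thesis
    proof (cases "(i \<ge> 0) = (j \<ge> 0)")
      case True
      hence "i * j \<ge> 0" by (auto intro: mult_nonneg_nonneg mult_nonpos_nonpos)
      hence "norm (q powi (b * (i * j))) \<le> 1"
        unfolding norm_power_int using q b_pos by (intro power_int_le_one) auto
      hence "norm (sw (i \<ge> 0) (j \<ge> 0)) * norm (q powi (b * (i * j))) * norm (?g p) \<le> 1 * 1 * norm (?g p)"
        by (intro mult_mono norm_sw_le) auto
      moreover have "?f p = sw (i \<ge> 0) (j \<ge> 0) * (q powi (b * (i * j)) * ?g p)"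
        unfolding eq[symmetric] by (simp add: p)
      ultimately show ?thesis by (simp add: norm_mult mult.assoc)
    next
      case False
      hence "?f p = 0" by (auto simp: p sw_def)
      thus ?thesis by simp
    qed
  qed
  have "?f summable_on UNIV"
    by (rule abs_summable_summable[OF Infinite_Sum.abs_summable_on_comparison_test'[OF g fg]])
  hence "(?f has_sum infsum ?f UNIV) UNIV" by (rule has_sum_infsum)
  also have "infsum ?f UNIV = hecke_f a b c (- u) (- v) q"
    unfolding hecke_f_def
  proof (rule infsum_cong_neutral)
    fix p :: "int \<times> int" assume "p \<in> UNIV \<inter> {(r, s). sg r = sg s}"
    then obtain i j where p: "p = (i, j)" "sg i = sg j" by auto
    have "(-1) powi (i + j) * (- u) powi i * (- v) powi j = u powi i * v powi j"
      by (simp add: power_int_minus_left power_int_add)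
    moreover have "sw (i \<ge> 0) (j \<ge> 0) = of_int (sg i)"
      using p by (auto simp: sg_def sw_def split: if_splits)
    ultimately show "?f p = (case p of (r, s) \<Rightarrow> of_int (sg r) * (-1) powi (r + s) * (- u) powi r * (- v) powi s *
        q powi (a * choose2 r + b * r * s + c * choose2 s))"
      by (simp add: p mono_def mult_ac)
  qed (auto simp: sg_def sw_def)
  finally show ?thesis .
qed

lemma term0_has_sum:
  "((\<lambda>(i, j, k, m). sw (i \<ge> 0) (j \<ge> 0) * T i j k m)
     has_sum (hecke_f a b c (- u) (- v) q * (jtheta (-1) Q1 * jtheta (-1) Q0))) UNIV"
proof -
  have "((\<lambda>((i, j), (k, m)). (sw (i \<ge> 0) (j \<ge> 0) * mono (a * choose2 i + b * i * j + c * choose2 j) i j) *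
     (Q1 powi choose2 k * Q0 powi choose2 m))
     has_sum (hecke_f a b c (- u) (- v) q * (jtheta (-1) Q1 * jtheta (-1) Q0))) (UNIV \<times> (UNIV \<times> UNIV))"
    using has_sum_times[OF hecke_has_sum has_sum_times[OF theta_one_has_sum[OF Q1] theta_one_has_sum[OF Q0]]]
    by (simp add: case_prod_unfold)
  also have "?this \<longleftrightarrow> ?thesis"
    by (rule has_sum_reindex_bij_witness[of _ "\<lambda>(i, j, k, m). ((i, j), (k, m))" "\<lambda>((i, j), (k, m)). (i, j, k, m)"])
       (auto simp: T_def Q1_def Q0_def q_mono mono_mult mono_powi algebra_simps)
  finally show ?thesis .
qed

end

text \<open>The symmetry by which the second Appell-Lerch term follows from the first.\<close>

lemma hecke_form_swap:
  assumes "hecke_form a b c \<alpha> \<gamma> D q u v"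
  shows "hecke_form c b a \<gamma> \<alpha> D q v u"
  using assms by (simp add: hecke_form_def mult.commute)

context hecke_form
begin

interpretation swap: hecke_form c b a \<gamma> \<alpha> D q v u
  by (rule hecke_form_swap) unfold_locales

lemma swap_simps: "swap.mono e i j = mono e j i" "swap.Y0 = X0" "swap.Q1 = Q0" "swap.Q0 = Q1" "swap.A1 = A0"
  "swap.T j i m k = T i j k m"
proof -
  show *: "swap.mono e i j = mono e j i" for e i j
    by (simp add: mono_def swap.mono_def)
  show 1: "swap.Q1 = Q0" "swap.Q0 = Q1" by (simp_all add: swap.Q1_def Q1_def swap.Q0_def Q0_def)
  show 2: "swap.Y0 = X0" by (simp add: swap.Y0_def X0_def *)
  show "swap.A1 = A0" by (simp add: swap.A1_def A0_def 1 2)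
  show "swap.T j i m k = T i j k m"
    by (simp add: swap.T_def T_def * algebra_simps)
qed

lemma term2_has_sum:
  assumes X: "\<And>k::int. norm (Q0 powi k * X0) \<noteq> 1"
  shows "((\<lambda>(i, j, k, m). sw (norm (Q0 powi (m - i) * X0) < 1) (i \<ge> 0) * T i j k m)
     has_sum (jtheta (- v) (q powi c) * (A0 * jtheta (-1) Q1))) UNIV"
proof -
  have "((\<lambda>(j, i, m, k). sw (norm (Q0 powi (m - i) * X0) < 1) (i \<ge> 0) * T i j k m)
     has_sum (jtheta (- v) (q powi c) * (A0 * jtheta (-1) Q1))) UNIV"
    using swap.term1_has_sum unfolding swap_simps using X by simp
  also have "?this \<longleftrightarrow> ?thesis"
    by (rule has_sum_reindex_bij_witness[of _ "\<lambda>(i, j, k, m). (j, i, m, k)" "\<lambda>(j, i, m, k). (i, j, k, m)"]) auto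
  finally show ?thesis .
qed

text \<open>\<open>sw_combine\<close> applied termwise. The value is what the theta part must equal
  once the identity is multiplied by j(-1;Q1) j(-1;Q0).\<close>

lemma theta_quadruple_has_sum:
  assumes X: "\<And>k::int. norm (Q0 powi k * X0) \<noteq> 1" and Y: "\<And>k::int. norm (Q1 powi k * Y0) \<noteq> 1"
  shows "((\<lambda>(i, j, k, m). sw (norm (Q1 powi (k - j) * Y0) < 1) (norm (Q0 powi (m - i) * X0) < 1) * T i j k m)
     has_sum (jtheta (- u) (q powi a) * (A1 * jtheta (-1) Q0) + jtheta (- v) (q powi c) * (A0 * jtheta (-1) Q1)
       - hecke_f a b c (- u) (- v) q * (jtheta (-1) Q1 * jtheta (-1) Q0))) UNIV"
proof -
  have "(case p of (i, j, k, m) \<Rightarrow> sw (norm (Q1 powi (k - j) * Y0) < 1) (j \<ge> 0) * T i j k m) +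
        (case p of (i, j, k, m) \<Rightarrow> sw (norm (Q0 powi (m - i) * X0) < 1) (i \<ge> 0) * T i j k m) -
        (case p of (i, j, k, m) \<Rightarrow> sw (i \<ge> 0) (j \<ge> 0) * T i j k m) =
        (case p of (i, j, k, m) \<Rightarrow> sw (norm (Q1 powi (k - j) * Y0) < 1) (norm (Q0 powi (m - i) * X0) < 1) * T i j k m)" for p
  proof -
    obtain i j k m where p: "p = (i, j, k, m)" by (metis surj_pair)
    show ?thesis
      unfolding p prod.case sw_combine[of "norm (Q1 powi (k - j) * Y0) < 1" "norm (Q0 powi (m - i) * X0) < 1" "j \<ge> 0" "i \<ge> 0"]
      by (simp add: algebra_simps)
  qed
  with has_sum_minus[OF has_sum_add[OF term1_has_sum[OF Y] term2_has_sum[OF X]] term0_has_sum]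
  show ?thesis by simp
qed

end

section \<open>Splitting into theta functions\<close>

context hecke_form
begin

text \<open>A summand of \<open>theta_abc\<close>, with the first index raised by one so that it
  runs over 1..\<gamma>.\<close>

definition theta_term :: "int \<Rightarrow> int \<Rightarrow> int \<Rightarrow> complex" where
  "theta_term d e f =
     mono (c * D * choose2 d + a * D * choose2 (e + f + 1) + a * choose2 f) f 0 *
     (jtheta (- mono (c * D * d + b * f) 0 1) (q powi (b * \<alpha>)) *
      jtheta (- mono (b * D * (e + f + 1) - c * D * d + \<alpha> * \<gamma> * (a * choose2 \<alpha>)) \<alpha> (-1)) (q powi (b * \<alpha> * D))) *
     (qpoch_inf Q Q ^ 3 * jtheta ((Q0 powi (e + 1) * X0) * (Q1 powi d * Y0)) Q /
       (jtheta (Q0 powi (e + 1) * X0) Q * jtheta (Q1 powi d * Y0) Q))"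

text \<open>Separation of variables: the exponent splits into a constant, a part in K, a part in l
  and a part in (s, t), belonging to two theta series and Kronecker's sum.\<close>

lemma theta_exponent:
  assumes "i = f + \<alpha> * l + s - \<alpha> * t" "j = K - l - \<gamma> * s + t" "k = d + K - l + t" "m = e + 1 + f + \<alpha> * l + s"
  shows "a * choose2 i + b * i * j + c * choose2 j + c * D * choose2 k + a * D * choose2 m =
    (c * D * choose2 d + a * D * choose2 (e + f + 1) + a * choose2 f) +
    (b * \<alpha> * choose2 K + (c * D * d + b * f) * K) +
    (b * \<alpha> * D * choose2 l + (b * D * (e + f + 1) - c * D * d + \<alpha> * \<gamma> * (a * choose2 \<alpha>)) * l) +
    (b * D * (s * t) + (a * D * (e + 1) - c * choose2 \<gamma>) * s + (c * D * d - a * choose2 \<alpha>) * t)" (is "?l = ?r")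
proof -
  \<comment> \<open>The relation a \<alpha> = c \<gamma> is eliminated by a = z \<gamma>, c = z
    \<alpha>, b = z \<alpha> \<gamma>. As z may be fractional, the identity is checked over the
    reals.\<close>
  define z where "z = real_of_int a / of_int \<gamma>"
  have ra: "real_of_int a = z * of_int \<gamma>" using pos by (simp add: z_def)
  have rb: "real_of_int b = z * of_int \<gamma> * of_int \<alpha>" using ra by (simp add: b_a)
  have rc: "real_of_int c = z * of_int \<alpha>"
  proof -
    have "real_of_int c * of_int \<gamma> = z * of_int \<alpha> * of_int \<gamma>"
      using rb b_c by (simp add: mult_ac flip: of_int_mult)
    thus ?thesis using pos by simp
  qed
  have ch: "real_of_int (choose2 n) = of_int n * (of_int n - 1) / 2" for n
    using arg_cong[OF choose2_double[of n], of real_of_int] by simp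
  have "real_of_int ?l = real_of_int ?r"
    unfolding assms of_int_add of_int_diff of_int_mult ch ra rb rc D_eq of_int_1
    by (simp add: field_simps)
  thus ?thesis by (simp only: of_int_eq_iff)
qed

text \<open>Since Q = Q1^\<gamma> = Q0^\<alpha>, Kronecker's sum with base Q carries the weight of
  the fourfold sum at the fixed residues \<open>d\<close> and \<open>e + 1\<close>.\<close>

lemma theta_term_has_sum:
  assumes X: "\<And>k::int. norm (Q0 powi k * X0) \<noteq> 1" and Y: "\<And>k::int. norm (Q1 powi k * Y0) \<noteq> 1"
  shows "((\<lambda>((s, t), (K, l)). sw (norm (Q1 powi (\<gamma> * s + d) * Y0) < 1) (norm (Q0 powi (\<alpha> * t + e + 1) * X0) < 1) *
       T (f + \<alpha> * l + s - \<alpha> * t) (K - l - \<gamma> * s + t) (d + K - l + t) (e + 1 + f + \<alpha> * l + s))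
     has_sum theta_term d e f) UNIV"
proof -
  have qq: "q powi (b * \<alpha>) \<noteq> 0" "norm (q powi (b * \<alpha>)) < 1"
    "q powi (b * \<alpha> * D) \<noteq> 0" "norm (q powi (b * \<alpha> * D)) < 1"
    using q_powi pos b_pos D_pos by simp_all
  have QQ1: "Q powi s * (Q1 powi d * Y0) = Q1 powi (\<gamma> * s + d) * Y0" for s
    unfolding Q_def Q1_def Y0_def q_mono mono_mult mono_powi
    by (rule arg_cong3[where f = mono]) (simp_all add: b_c algebra_simps)
  have QQ0: "Q powi t * (Q0 powi (e + 1) * X0) = Q0 powi (\<alpha> * t + e + 1) * X0" for t
    unfolding Q_def Q0_def X0_def q_mono mono_mult mono_powi
    by (rule arg_cong3[where f = mono]) (simp_all add: b_a algebra_simps)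
  define C where "C = mono (c * D * choose2 d + a * D * choose2 (e + f + 1) + a * choose2 f) f 0"
  define w1 where "w1 = mono (c * D * d + b * f) 0 1"
  define w2 where "w2 = mono (b * D * (e + f + 1) - c * D * d + \<alpha> * \<gamma> * (a * choose2 \<alpha>)) \<alpha> (-1)"
  have k: "((\<lambda>(s, t). sw (norm (Q powi s * (Q1 powi d * Y0)) < 1) (norm (Q powi t * (Q0 powi (e + 1) * X0)) < 1) *
            (Q powi (s * t) * (Q0 powi (e + 1) * X0) powi s * (Q1 powi d * Y0) powi t))
     has_sum (qpoch_inf Q Q ^ 3 * jtheta ((Q0 powi (e + 1) * X0) * (Q1 powi d * Y0)) Q /
       (jtheta (Q0 powi (e + 1) * X0) Q * jtheta (Q1 powi d * Y0) Q))) (UNIV \<times> UNIV)"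
  proof (rule kronecker_double_sum[OF Q])
    show "Q0 powi (e + 1) * X0 \<noteq> 0" "Q1 powi d * Y0 \<noteq> 0"
      using Q0 Q1 by (simp_all add: X0_def Y0_def mono_nz)
  qed (simp_all only: QQ1 QQ0 X Y not_False_eq_True)
  have t1: "((\<lambda>K. (q powi (b * \<alpha>)) powi choose2 K * w1 powi K) has_sum jtheta (- w1) (q powi (b * \<alpha>))) UNIV"
    by (rule jacobi_triple_product) (use qq in \<open>auto simp: w1_def mono_nz\<close>)
  have t2: "((\<lambda>l. (q powi (b * \<alpha> * D)) powi choose2 l * w2 powi l) has_sum jtheta (- w2) (q powi (b * \<alpha> * D))) UNIV"
    by (rule jacobi_triple_product) (use qq in \<open>auto simp: w2_def mono_nz\<close>)
  have "((\<lambda>p. C * (case p of ((s, t), (K, l)) \<Rightarrow>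
      (sw (norm (Q powi s * (Q1 powi d * Y0)) < 1) (norm (Q powi t * (Q0 powi (e + 1) * X0)) < 1) *
            (Q powi (s * t) * (Q0 powi (e + 1) * X0) powi s * (Q1 powi d * Y0) powi t)) *
      (((q powi (b * \<alpha>)) powi choose2 K * w1 powi K) * ((q powi (b * \<alpha> * D)) powi choose2 l * w2 powi l))))
      has_sum (C * ((qpoch_inf Q Q ^ 3 * jtheta ((Q0 powi (e + 1) * X0) * (Q1 powi d * Y0)) Q /
       (jtheta (Q0 powi (e + 1) * X0) Q * jtheta (Q1 powi d * Y0) Q)) *
       (jtheta (- w1) (q powi (b * \<alpha>)) * jtheta (- w2) (q powi (b * \<alpha> * D)))))) UNIV"
    using has_sum_cmult_right[OF has_sum_times[OF k has_sum_times[OF t1 t2]], of C]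
    by (simp add: case_prod_unfold)
  also have "C * ((qpoch_inf Q Q ^ 3 * jtheta ((Q0 powi (e + 1) * X0) * (Q1 powi d * Y0)) Q /
       (jtheta (Q0 powi (e + 1) * X0) Q * jtheta (Q1 powi d * Y0) Q)) *
       (jtheta (- w1) (q powi (b * \<alpha>)) * jtheta (- w2) (q powi (b * \<alpha> * D)))) = theta_term d e f"
    by (simp add: theta_term_def C_def w1_def w2_def mult_ac)
  also have "(\<lambda>p. C * (case p of ((s, t), (K, l)) \<Rightarrow>
      (sw (norm (Q powi s * (Q1 powi d * Y0)) < 1) (norm (Q powi t * (Q0 powi (e + 1) * X0)) < 1) *
            (Q powi (s * t) * (Q0 powi (e + 1) * X0) powi s * (Q1 powi d * Y0) powi t)) *
      (((q powi (b * \<alpha>)) powi choose2 K * w1 powi K) * ((q powi (b * \<alpha> * D)) powi choose2 l * w2 powi l)))) =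
     (\<lambda>((s, t), (K, l)). sw (norm (Q1 powi (\<gamma> * s + d) * Y0) < 1) (norm (Q0 powi (\<alpha> * t + e + 1) * X0) < 1) *
       T (f + \<alpha> * l + s - \<alpha> * t) (K - l - \<gamma> * s + t) (d + K - l + t) (e + 1 + f + \<alpha> * l + s))" (is "?L = ?R")
  proof (rule ext)
    fix p :: "(int \<times> int) \<times> int \<times> int"
    obtain s t K l where p: "p = ((s, t), (K, l))" by (metis surj_pair)
    have m: "C * (Q powi (s * t) * (Q0 powi (e + 1) * X0) powi s * (Q1 powi d * Y0) powi t *
       (((q powi (b * \<alpha>)) powi choose2 K * w1 powi K) * ((q powi (b * \<alpha> * D)) powi choose2 l * w2 powi l))) =
       T (f + \<alpha> * l + s - \<alpha> * t) (K - l - \<gamma> * s + t) (d + K - l + t) (e + 1 + f + \<alpha> * l + s)"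
      unfolding T_def theta_exponent[OF refl refl refl refl]
      unfolding C_def w1_def w2_def Q_def Q0_def Q1_def X0_def Y0_def q_mono mono_mult mono_powi
      by (rule arg_cong3[where f = mono]) (simp_all add: algebra_simps)
    show "?L p = ?R p"
      unfolding p prod.case m[symmetric] QQ1 QQ0 by (simp only: mult_ac)
  qed
  finally show ?thesis .
qed

theorem theta_sum:
  assumes X: "\<And>k::int. norm (Q0 powi k * X0) \<noteq> 1" and Y: "\<And>k::int. norm (Q1 powi k * Y0) \<noteq> 1"
  shows "(\<Sum>d=1..\<gamma>. \<Sum>e=0..\<alpha>-1. \<Sum>f=0..\<alpha>-1. theta_term d e f) =
     jtheta (- u) (q powi a) * (A1 * jtheta (-1) Q0) + jtheta (- v) (q powi c) * (A0 * jtheta (-1) Q1)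
       - hecke_f a b c (- u) (- v) q * (jtheta (-1) Q1 * jtheta (-1) Q0)" (is "_ = ?R")
proof -
  define I where "I = {1..\<gamma>} \<times> {0..\<alpha>-1} \<times> {0..\<alpha>-1}"
  define h where "h = (\<lambda>(i, j, k, m). sw (norm (Q1 powi (k - j) * Y0) < 1) (norm (Q0 powi (m - i) * X0) < 1) * T i j k m)"
  define fw :: "(int \<times> int \<times> int) \<times> (int \<times> int) \<times> (int \<times> int) \<Rightarrow> int \<times> int \<times> int \<times> int" where
    "fw = (\<lambda>((d, e, f), ((s, t), (K, l))).
      (f + \<alpha> * l + s - \<alpha> * t, K - l - \<gamma> * s + t, d + K - l + t, e + 1 + f + \<alpha> * l + s))"
  \<comment> \<open>The inverse by Euclidean division: k - j = \<gamma> s + d with 1 \<le> d \<le>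
    \<gamma>, m - i = \<alpha> t + e + 1 with 0 \<le> e < \<alpha>, and i - s + \<alpha> t =
    \<alpha> l + f. Subtracting 1 before dividing produces these ranges.\<close>
  define bw :: "int \<times> int \<times> int \<times> int \<Rightarrow> (int \<times> int \<times> int) \<times> (int \<times> int) \<times> (int \<times> int)" where
    "bw = (\<lambda>(i, j, k, m). let s = (k - j - 1) div \<gamma>; t = (m - i - 1) div \<alpha>; n = i - s + \<alpha> * t in
      (((k - j - 1) mod \<gamma> + 1, (m - i - 1) mod \<alpha>, n mod \<alpha>), ((s, t), (j + n div \<alpha> + \<gamma> * s - t, n div \<alpha>))))"
  have dm: "(r + n * s) div n = s" "(r + n * s) mod n = r" if "0 \<le> r" "r < n" for r n s :: int
    using that by (auto simp: div_pos_pos_trivial mod_pos_pos_trivial)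
  have "(h has_sum ?R) UNIV"
    unfolding h_def by (rule theta_quadruple_has_sum[OF X Y])
  moreover have "((\<lambda>p. h (fw p)) has_sum ?R) (I \<times> UNIV) \<longleftrightarrow> (h has_sum ?R) UNIV"
  proof (rule has_sum_reindex_bij_witness[of _ bw fw], goal_cases)
    case (1 p)
    then obtain d e f s t K l where p: "p = ((d, e, f), ((s, t), (K, l)))" "d \<in> {1..\<gamma>}" "e \<in> {0..\<alpha>-1}" "f \<in> {0..\<alpha>-1}"
      by (auto simp: I_def)
    have "(d + K - l + t) - (K - l - \<gamma> * s + t) - 1 = (d - 1) + \<gamma> * s"
      "(e + 1 + f + \<alpha> * l + s) - (f + \<alpha> * l + s - \<alpha> * t) - 1 = e + \<alpha> * t"
      "(f + \<alpha> * l + s - \<alpha> * t) - s + \<alpha> * t = f + \<alpha> * l" by simp_all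
    thus ?case
      using p(2-4) by (simp only: p(1) fw_def bw_def prod.case Let_def dm) (simp add: dm)
  next
    case (3 p)
    obtain i j k m where p: "p = (i, j, k, m)" by (metis surj_pair)
    show ?case
      unfolding p fw_def bw_def prod.case Let_def
      using mod_mult_div_eq[of "k - j - 1" \<gamma>] mod_mult_div_eq[of "m - i - 1" \<alpha>]
        mod_mult_div_eq[of "i - (k - j - 1) div \<gamma> + \<alpha> * ((m - i - 1) div \<alpha>)" \<alpha>]
      by (simp only: prod.inject) linarith
  next
    case (4 p)
    obtain i j k m where p: "p = (i, j, k, m)" by (metis surj_pair)
    have "0 \<le> n mod \<gamma>" "n mod \<gamma> < \<gamma>" "0 \<le> n mod \<alpha>" "n mod \<alpha> < \<alpha>" for n
      using pos by simp_all
    thus ?case by (auto simp: p bw_def I_def Let_def intro: add1_zle_eq[THEN iffD2])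
  qed (auto simp: I_def)
  ultimately have "((\<lambda>p. h (fw p)) has_sum ?R) (I \<times> UNIV)" by simp
  hence "((\<lambda>(d, e, f). theta_term d e f) has_sum ?R) I"
  proof (rule has_sum_SigmaD)
    fix x :: "int \<times> int \<times> int"
    obtain d e f where x: "x = (d, e, f)" by (metis surj_pair)
    have "(\<lambda>y. h (fw (x, y))) = (\<lambda>((s, t), (K, l)). sw (norm (Q1 powi (\<gamma> * s + d) * Y0) < 1) (norm (Q0 powi (\<alpha> * t + e + 1) * X0) < 1) *
       T (f + \<alpha> * l + s - \<alpha> * t) (K - l - \<gamma> * s + t) (d + K - l + t) (e + 1 + f + \<alpha> * l + s))" (is "?L = ?R")
    proof (rule ext)
      fix y :: "(int \<times> int) \<times> int \<times> int"
      obtain s t K l where y: "y = ((s, t), (K, l))" by (metis surj_pair)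
      have "(d + K - l + t) - (K - l - \<gamma> * s + t) = \<gamma> * s + d"
        "(e + 1 + f + \<alpha> * l + s) - (f + \<alpha> * l + s - \<alpha> * t) = \<alpha> * t + e + 1" by simp_all
      thus "?L y = ?R y"
        by (simp only: h_def fw_def x y prod.case)
    qed
    thus "((\<lambda>y. h (fw (x, y))) has_sum (case x of (d, e, f) \<Rightarrow> theta_term d e f)) UNIV"
      using theta_term_has_sum[OF X Y, of d e f] by (simp add: x)
  qed
  moreover have "finite I" by (simp add: I_def)
  ultimately have "(\<Sum>(d, e, f)\<in>I. theta_term d e f) = ?R"
    using has_sum_finite has_sum_unique by blast
  thus ?thesis
    by (simp add: I_def sum.cartesian_product case_prod_unfold)
qed

end

section \<open>Continuity in the first argument\<close>

text \<open>The factors of (Q;Q), grouped by exponent modulo 3, are the three products in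
  j(Q;Q^3).\<close>

lemma J1_eq:
  assumes "q \<noteq> 0" "norm (q powi m) < 1"
  shows "J1 m q = qpoch_inf (q powi m) (q powi m)"
proof -
  define Q where "Q = q powi m"
  have Q: "Q \<noteq> 0" "norm Q < 1" "norm (Q ^ 3) < 1"
    using assms by (simp_all add: Q_def norm_power power_less_one_iff)
  have split: "(\<Prod>i<3 * n. 1 - Q ^ i * Q) = (\<Prod>i<n. 1 - (Q ^ 3) ^ i * Q) *
      (\<Prod>i<n. 1 - (Q ^ 3) ^ i * (Q ^ 3 / Q)) * (\<Prod>i<n. 1 - (Q ^ 3) ^ i * Q ^ 3)" for n
  proof (induction n)
    case (Suc n)
    have "3 * Suc n = Suc (Suc (Suc (3 * n)))" by simp
    hence step: "(\<Prod>i<3 * Suc n. 1 - Q ^ i * Q) = (\<Prod>i<3 * n. 1 - Q ^ i * Q) *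
        ((1 - Q ^ (3 * n) * Q) * (1 - Q ^ (3 * n) * (Q * Q)) * (1 - Q ^ (3 * n) * (Q * Q * Q)))"
      by (simp only: prod.lessThan_Suc) (simp add: mult_ac)
    have f: "1 - (Q ^ 3) ^ n * Q = 1 - Q ^ (3 * n) * Q"
        "1 - (Q ^ 3) ^ n * (Q ^ 3 / Q) = 1 - Q ^ (3 * n) * (Q * Q)"
        "1 - (Q ^ 3) ^ n * Q ^ 3 = 1 - Q ^ (3 * n) * (Q * Q * Q)"
      using Q by (simp_all only: power_mult) (simp_all add: power3_eq_cube)
    show ?case unfolding step Suc.IH prod.lessThan_Suc f by (simp only: mult_ac)
  qed simp
  have "(\<lambda>n. \<Prod>i<3 * n. 1 - Q ^ i * Q) \<longlonglongrightarrow> qpoch_inf Q Q"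
    by (rule filterlim_compose[OF qpoch_inf_LIMSEQ[OF Q(2)]]) (intro filterlim_subseq strict_monoI, simp)
  moreover have "(\<lambda>n. \<Prod>i<3 * n. 1 - Q ^ i * Q) \<longlonglongrightarrow> jtheta Q (Q ^ 3)"
    unfolding split jtheta_def by (intro tendsto_mult qpoch_inf_LIMSEQ Q)
  moreover have "q powi (3 * m) = Q ^ 3"
    by (simp add: Q_def power_int_mult mult.commute[of 3])
  ultimately show ?thesis
    unfolding J1_def J2_def Q_def[symmetric] by (metis LIMSEQ_unique)
qed

text \<open>Powers increase with the base for k \<ge> 0 and decrease for k < 0. Adding both endpoint
  values gives one majorant for a whole annulus and all integer exponents.\<close>

lemma powi_le_sum_bounds:
  fixes lo hi r :: real
  assumes "0 < lo" "lo \<le> r" "r \<le> hi"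
  shows "r powi k \<le> lo powi k + hi powi k"
proof (cases "k \<ge> 0")
  case True
  hence "r powi k \<le> hi powi k" using assms by (intro power_int_mono) auto
  thus ?thesis using assms zero_le_power_int[of lo k] by linarith
next
  case False
  hence "r powi k \<le> lo powi k" using assms by (intro power_int_antimono) auto
  moreover have "0 \<le> hi powi k" using assms by (intro zero_le_power_int) auto
  ultimately show ?thesis by linarith
qed

lemma eventually_norm_between:
  fixes z :: complex
  assumes "z \<noteq> 0"
  shows "\<forall>\<^sub>F w in nhds z. norm z / 2 \<le> norm w \<and> norm w \<le> 2 * norm z"
proof -
  have nz: "((\<lambda>w. norm w) \<longlongrightarrow> norm z) (nhds z)"
    by (intro tendsto_intros filterlim_ident)
  have "\<forall>\<^sub>F w in nhds z. norm z / 2 < norm w" "\<forall>\<^sub>F w in nhds z. norm w < 2 * norm z"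
    by (rule order_tendstoD[OF nz], use assms in simp)+
  thus ?thesis by eventually_elim simp
qed

text \<open>Dominated convergence of the theta series: near \<open>z\<close> the modulus stays
  between |z|/2 and 2|z|, and each endpoint gives a convergent Gauss series.\<close>

lemma jtheta_tendsto_nhds:
  assumes q: "q \<noteq> 0" "norm q < 1" and z: "z \<noteq> 0"
  shows "((\<lambda>w. jtheta w q) \<longlongrightarrow> jtheta z q) (nhds z)"
proof -
  have sum: "(\<lambda>k. norm q powi choose2 k * ((norm z / 2) powi k + (2 * norm z) powi k)) summable_on UNIV"
    unfolding distrib_left using q z by (intro summable_on_add summable_on_gauss_real) auto
  have "((\<lambda>w. \<Sum>\<^sub>\<infinity>k. q powi choose2 k * (- w) powi k) \<longlongrightarrow> (\<Sum>\<^sub>\<infinity>k. q powi choose2 k * (- z) powi k)) (nhds z)"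
  proof (rule tendsto_infsum_dominated[OF _ _ sum])
    show "((\<lambda>w. q powi choose2 k * (- w) powi k) \<longlongrightarrow> q powi choose2 k * (- z) powi k) (nhds z)" for k
      using z by (intro tendsto_intros filterlim_ident) auto
    show "\<forall>\<^sub>F w in nhds z. \<forall>k\<in>UNIV. norm (q powi choose2 k * (- w) powi k) \<le>
       norm q powi choose2 k * ((norm z / 2) powi k + (2 * norm z) powi k)"
      using eventually_norm_between[OF z]
    proof eventually_elim
      case (elim w)
      hence "norm w powi k \<le> (norm z / 2) powi k + (2 * norm z) powi k" for k
        using z by (intro powi_le_sum_bounds) auto
      thus ?case
        unfolding norm_mult norm_power_int norm_minus_cancel by (intro ballI mult_left_mono) auto
    qed
  qed simp
  moreover have "(\<Sum>\<^sub>\<infinity>k. q powi choose2 k * (- w) powi k) = jtheta w q" if "w \<noteq> 0" for w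
    by (rule infsumI[OF jtheta_has_sum[OF q that]])
  moreover have "\<forall>\<^sub>F w in nhds z. w \<noteq> 0"
    using z by (rule t1_space_nhds)
  ultimately show ?thesis
    using z by (force elim: Lim_transform_eventually eventually_mono)
qed

lemma tendsto_jtheta:
  assumes "q \<noteq> 0" "norm q < 1" "z \<noteq> 0" "(f \<longlongrightarrow> z) F"
  shows "((\<lambda>n. jtheta (f n) q) \<longlongrightarrow> jtheta z q) F"
  by (rule filterlim_compose[OF jtheta_tendsto_nhds[OF assms(1-3)] assms(4)])

text \<open>Continuity holds wherever no denominator vanishes, including points with some |q^k Y| =
  1, where the geometric expansion fails; this permits the passage to the critical circles.\<close>

lemma tendsto_appell_sum:
  fixes q Y :: complex
  assumes q: "q \<noteq> 0" "norm q < 1" and Y: "Y \<noteq> 0" "\<And>k::int. q powi k * Y \<noteq> 1" and f: "(f \<longlongrightarrow> Y) F"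
  shows "((\<lambda>n. \<Sum>\<^sub>\<infinity>r. q powi choose2 r / (1 - q powi r * f n)) \<longlongrightarrow>
           (\<Sum>\<^sub>\<infinity>r. q powi choose2 r / (1 - q powi r * Y))) F"
proof -
  obtain \<delta> where \<delta>: "\<delta> > 0" "\<forall>\<^sub>F Z in nhds Y. \<forall>k::int. \<delta> \<le> norm (1 - q powi k * Z)"
    using one_minus_bounded_below[OF q Y] by blast
  have g: "(\<lambda>k. norm (q powi choose2 k) / \<delta>) summable_on UNIV"
    using summable_on_cmult_left[OF summable_on_gauss[OF q, of 1], of "inverse \<delta>"]
    by (simp add: divide_inverse)
  have "((\<lambda>Z. \<Sum>\<^sub>\<infinity>r. q powi choose2 r / (1 - q powi r * Z)) \<longlongrightarrow>
           (\<Sum>\<^sub>\<infinity>r. q powi choose2 r / (1 - q powi r * Y))) (nhds Y)"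
  proof (rule tendsto_infsum_dominated[OF _ _ g])
    show "((\<lambda>Z. q powi choose2 r / (1 - q powi r * Z)) \<longlongrightarrow> q powi choose2 r / (1 - q powi r * Y)) (nhds Y)" for r
      using Y(2)[of r] by (intro tendsto_intros filterlim_ident) auto
    show "\<forall>\<^sub>F Z in nhds Y. \<forall>r\<in>UNIV. norm (q powi choose2 r / (1 - q powi r * Z)) \<le> norm (q powi choose2 r) / \<delta>"
      using \<delta>(2)
    proof eventually_elim
      case (elim Z)
      show ?case
      proof
        fix r :: int
        show "norm (q powi choose2 r / (1 - q powi r * Z)) \<le> norm (q powi choose2 r) / \<delta>"
          unfolding norm_divide using \<delta>(1) elim[rule_format, of r]
            less_le_trans[OF \<delta>(1) elim[rule_format, of r]]
          by (intro divide_left_mono mult_pos_pos norm_ge_zero)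
      qed
    qed
  qed simp
  thus ?thesis by (rule filterlim_compose[OF _ f])
qed

text \<open>On the summation range rs \<ge> 0, so |q^(brs)| \<le> 1 and the majorant factors into
  Gauss series in r and s.\<close>

lemma tendsto_hecke_f:
  fixes a b c :: int
  assumes abc: "a > 0" "b > 0" "c > 0" and q: "q \<noteq> 0" "norm q < 1" and x: "x \<noteq> 0" and y: "y \<noteq> 0"
    and f: "(f \<longlongrightarrow> x) F"
  shows "((\<lambda>n. hecke_f a b c (f n) y q) \<longlongrightarrow> hecke_f a b c x y q) F"
proof -
  define h1 where "h1 = (\<lambda>r. (norm q powi a) powi choose2 r * ((norm x / 2) powi r + (2 * norm x) powi r))"
  define h2 where "h2 = (\<lambda>s. (norm q powi c) powi choose2 s * norm y powi s)"
  have qp: "0 < norm q powi e" "norm q powi e < 1" if "e > 0" for e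
    using q that by (simp_all add: power_int_nonneg_exp power_less_one_iff)
  have h1: "h1 summable_on UNIV"
    unfolding h1_def distrib_left using qp abc x by (intro summable_on_add summable_on_gauss_real) auto
  have h2: "h2 summable_on UNIV"
    unfolding h2_def using qp abc y by (intro summable_on_gauss_real) auto
  have h_nonneg: "h1 r \<ge> 0" "h2 s \<ge> 0" for r s by (simp_all add: h1_def h2_def)
  have "(\<lambda>(r, s). h1 r * h2 s) summable_on (UNIV \<times> UNIV)"
  proof (rule summable_on_SigmaI)
    show "((\<lambda>s. case (r, s) of (r, s) \<Rightarrow> h1 r * h2 s) has_sum (h1 r * infsum h2 UNIV)) UNIV" for r
      using has_sum_cmult_right[OF has_sum_infsum[OF h2]] by simp
    show "(\<lambda>r. h1 r * infsum h2 UNIV) summable_on UNIV"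
      by (rule summable_on_cmult_left[OF h1])
  qed (use h_nonneg in auto)
  hence h: "(\<lambda>(r, s). h1 r * h2 s) summable_on {(r, s). sg r = sg s}"
    by (rule summable_on_subset) auto
  have "((\<lambda>z. hecke_f a b c z y q) \<longlongrightarrow> hecke_f a b c x y q) (nhds x)"
    unfolding hecke_f_def
  proof (rule tendsto_infsum_dominated[OF _ _ h])
    fix p :: "int \<times> int"
    show "((\<lambda>z. case p of (r, s) \<Rightarrow> of_int (sg r) * (-1) powi (r + s) * z powi r * y powi s *
        q powi (a * choose2 r + b * r * s + c * choose2 s)) \<longlongrightarrow>
       (case p of (r, s) \<Rightarrow> of_int (sg r) * (-1) powi (r + s) * x powi r * y powi s *
        q powi (a * choose2 r + b * r * s + c * choose2 s))) (nhds x)"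
      using x by (cases p) (auto intro!: tendsto_intros filterlim_ident)
  next
    show "\<forall>\<^sub>F z in nhds x. \<forall>p\<in>{(r, s). sg r = sg s}.
       norm (case p of (r, s) \<Rightarrow> of_int (sg r) * (-1) powi (r + s) * z powi r * y powi s *
        q powi (a * choose2 r + b * r * s + c * choose2 s)) \<le> (case p of (r, s) \<Rightarrow> h1 r * h2 s)"
      using eventually_norm_between[OF x]
    proof eventually_elim
      case (elim z)
      show ?case
      proof (clarify)
        fix r s assume rs: "sg r = sg s"
        hence "r * s \<ge> 0"
          by (auto simp: sg_def split: if_splits intro: mult_nonneg_nonneg mult_nonpos_nonpos)
        hence le1: "norm q powi (b * (r * s)) \<le> 1"
          using q abc by (intro power_int_le_one) auto
        have "norm q powi (a * choose2 r + b * r * s + c * choose2 s) =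
          (norm q powi a) powi choose2 r * (norm q powi c) powi choose2 s * norm q powi (b * (r * s))"
          using q by (simp add: power_int_add mult.assoc flip: power_int_mult)
        also have "\<dots> \<le> (norm q powi a) powi choose2 r * (norm q powi c) powi choose2 s"
          using le1 by (intro mult_left_le) auto
        finally have 1: "norm q powi (a * choose2 r + b * r * s + c * choose2 s) \<le>
          (norm q powi a) powi choose2 r * (norm q powi c) powi choose2 s" .
        have 2: "norm z powi r \<le> (norm x / 2) powi r + (2 * norm x) powi r"
          using x elim by (intro powi_le_sum_bounds) auto
        have "norm (of_int (sg r) * (-1) powi (r + s) * z powi r * y powi s *
          q powi (a * choose2 r + b * r * s + c * choose2 s)) =
          norm z powi r * (norm y powi s * norm q powi (a * choose2 r + b * r * s + c * choose2 s))"
          by (simp add: norm_mult norm_power_int sg_def)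
        also have "\<dots> \<le> ((norm x / 2) powi r + (2 * norm x) powi r) *
           (norm y powi s * ((norm q powi a) powi choose2 r * (norm q powi c) powi choose2 s))"
          using 1 2 by (intro mult_mono mult_left_mono) auto
        also have "\<dots> = h1 r * h2 s" by (simp add: h1_def h2_def mult_ac)
        finally show "norm (of_int (sg r) * (-1) powi (r + s) * z powi r * y powi s *
          q powi (a * choose2 r + b * r * s + c * choose2 s)) \<le> h1 r * h2 s" .
      qed
    qed
  qed simp
  thus ?thesis by (rule filterlim_compose[OF _ f])
qed

section \<open>The identity off and on the critical circles\<close>

context hecke_form
begin

section \<open>Translation of the given functions into the locale's quantities\<close>

lemma div_simps:
  "b div a = \<alpha>" "b div c = \<gamma>" "b^2 div a = b * \<alpha>" "b^2 div c = b * \<gamma>" "b^2 div (a * c) = \<alpha> * \<gamma>"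
  "b * \<alpha> - c = c * D" "b * \<gamma> - a = a * D"
  "(b^3 * (b - a)) div (2 * a^2 * c) = \<alpha> * \<gamma> * (a * choose2 \<alpha>)"
proof -
  have nz: "a \<noteq> 0" "c \<noteq> 0" using pos by auto
  show "b div a = \<alpha>" using nz by (simp add: b_a)
  show "b div c = \<gamma>" using nz by (simp add: b_c)
  have "b^2 = a * (b * \<alpha>)" by (simp add: power2_eq_square) (simp add: b_a)
  thus "b^2 div a = b * \<alpha>" using nz by (simp only: nonzero_mult_div_cancel_left not_False_eq_True)
  have "b^2 = c * (b * \<gamma>)" by (simp add: power2_eq_square) (simp add: b_c)
  thus "b^2 div c = b * \<gamma>" using nz by (simp only: nonzero_mult_div_cancel_left not_False_eq_True)
  have "b * b = (a * \<alpha>) * (c * \<gamma>)" using b_a b_c by simp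
  hence b2: "b^2 = (a * c) * (\<alpha> * \<gamma>)" by (simp add: power2_eq_square mult_ac)
  have "a * c \<noteq> 0" using nz by simp
  thus "b^2 div (a * c) = \<alpha> * \<gamma>" unfolding b2 by (rule nonzero_mult_div_cancel_left)
  show "b * \<alpha> - c = c * D" by (simp add: cD b_a)
  show "b * \<gamma> - a = a * D" by (simp add: aD b_c)
  \<comment> \<open>Exactness of this division comes from b (b - a) = 2 a^2 C(\<alpha>, 2) and b^2 =
    a c \<alpha> \<gamma>.\<close>
  have "b^3 * (b - a) = b^2 * (b * (b - a))" by (simp add: power3_eq_cube power2_eq_square mult_ac)
  also have "b * (b - a) = a * a * (\<alpha> * (\<alpha> - 1))" by (simp add: b_a algebra_simps)
  also have "\<alpha> * (\<alpha> - 1) = 2 * choose2 \<alpha>" by (simp add: choose2_double)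
  also have "b^2 * (a * a * (2 * choose2 \<alpha>)) = (2 * a^2 * c) * (\<alpha> * \<gamma> * (a * choose2 \<alpha>))"
    unfolding b2 by (simp add: power2_eq_square mult_ac)
  finally have *: "b^3 * (b - a) = (2 * a^2 * c) * (\<alpha> * \<gamma> * (a * choose2 \<alpha>))" .
  have "2 * a^2 * c \<noteq> 0" using nz by simp
  thus "(b^3 * (b - a)) div (2 * a^2 * c) = \<alpha> * \<gamma> * (a * choose2 \<alpha>)"
    unfolding * by (rule nonzero_mult_div_cancel_left)
qed

lemma theta_abc_eq:
  "theta_abc a b c (- u) (- v) q = (\<Sum>d=1..\<gamma>. \<Sum>e=0..\<alpha>-1. \<Sum>f=0..\<alpha>-1. theta_term d e f)"
proof -
  have J: "J1 (b * D) q = qpoch_inf Q Q"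
    unfolding Q_def using q(1) Q(2)[unfolded Q_def] by (rule J1_eq)
  have de: "q powi (a * D * (e + 1) - c * choose2 \<gamma>) * u * v powi (- \<gamma>) = Q0 powi (e + 1) * X0" for e
    unfolding Q0_def X0_def q_mono[of "a * D"] mono_mult mono_powi by (simp add: mono_def)
  have dd: "q powi (c * D * (d + 1) - a * choose2 \<alpha>) * u powi (- \<alpha>) * v = Q1 powi (d + 1) * Y0" for d
    unfolding Q1_def Y0_def q_mono[of "c * D"] mono_mult mono_powi by (simp add: mono_def)
  have th: "theta_denom_e a b c (- u) (- v) q e = jtheta (Q0 powi (e + 1) * X0) Q"
    "theta_denom_d a b c (- u) (- v) q d = jtheta (Q1 powi (d + 1) * Y0) Q" for d e
    unfolding theta_denom_e_def theta_denom_d_def div_simps minus_minus D_eq[symmetric] de dd Q_def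
    by simp_all
  have j1: "q powi (c * D * (d + 1) + b * f) * (- v) = - mono (c * D * (d + 1) + b * f) 0 1" for d f
    by (simp add: mono_def)
  have j2: "q powi n * u powi \<alpha> * inverse (- v) = - mono n \<alpha> (-1)" for n
    by (simp add: mono_def power_int_minus)
  have j3: "q powi (a * D * (e + 1) + c * D * (d + 1) - c * choose2 \<gamma> - a * choose2 \<alpha>) * u powi (1 - \<alpha>) * v powi (1 - \<gamma>) =
     (Q0 powi (e + 1) * X0) * (Q1 powi (d + 1) * Y0)" for d e
    unfolding Q0_def X0_def Q1_def Y0_def q_mono u_mono v_mono mono_mult mono_powi
    by (rule arg_cong3[where f = mono]) (simp_all add: algebra_simps)
  have "theta_abc a b c (- u) (- v) q = (\<Sum>d=0..\<gamma>-1. \<Sum>e=0..\<alpha>-1. \<Sum>f=0..\<alpha>-1. theta_term (d + 1) e f)"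
    unfolding theta_abc_def div_simps minus_minus D_eq[symmetric] J th j1 j2 j3 Q_def[symmetric]
    by (intro sum.cong refl) (simp add: theta_term_def mono_def mult_ac)
  also have "\<dots> = (\<Sum>d=1..\<gamma>. \<Sum>e=0..\<alpha>-1. \<Sum>f=0..\<alpha>-1. theta_term d e f)"
    by (rule sum.reindex_bij_witness[of _ "\<lambda>d. d - 1" "\<lambda>d. d + 1"]) auto
  finally show ?thesis .
qed

lemma al_arg1_eq: "al_arg1 a b c (- u) (- v) q * - 1 = Q1 * Y0"
proof -
  have "2 * (a * choose2 \<alpha>) = a * (\<alpha> * (\<alpha> - 1))"
    using choose2_double[of \<alpha>] by (simp add: mult.left_commute)
  moreover have "choose2 (\<alpha> + 1) = choose2 \<alpha> + \<alpha>" by (simp add: choose2_add)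
  ultimately have "a * choose2 (\<alpha> + 1) - c = c * D - a * choose2 \<alpha>"
    by (simp only: cD) (simp add: algebra_simps)
  hence "a * choose2 (\<alpha> + 1) - c = c * D - a * choose2 \<alpha>" .
  thus ?thesis
    unfolding al_arg1_def div_simps minus_minus Q1_def Y0_def q_mono[of "c * D"] mono_mult
    by (simp add: mono_def mult_ac)
qed

text \<open>At z = -1 the signs (-1)^r z^r cancel, and the exponent r - 1 combines with
  \<open>Q1 * Y0\<close> to Q1^r Y0.\<close>

lemma appell_lerch_1: "appell_lerch (al_arg1 a b c (- u) (- v) q) Q1 (-1) = 1 / jtheta (-1) Q1 * A1"
proof -
  have 1: "Q1 powi (r - 1) * al_arg1 a b c (- u) (- v) q * - 1 = Q1 powi r * Y0" for r
    unfolding mult.assoc al_arg1_eq using Q1 by (simp add: power_int_diff)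
  have 2: "(-1 :: complex) powi r * z * (-1) powi r = z" for r z
    by (simp add: power_int_minus_left)
  show ?thesis
    unfolding appell_lerch_def A1_def 1 2 ..
qed

interpretation swap: hecke_form c b a \<gamma> \<alpha> D q v u
  by (rule hecke_form_swap) unfold_locales

lemma al_arg0_eq: "al_arg0 a b c (- u) (- v) q * - 1 = Q0 * X0"
  using swap.al_arg1_eq by (simp add: swap_simps al_arg0_def al_arg1_def)

lemma appell_lerch_0: "appell_lerch (al_arg0 a b c (- u) (- v) q) Q0 (-1) = 1 / jtheta (-1) Q0 * A0"
  using swap.appell_lerch_1 by (simp add: swap_simps al_arg0_def al_arg1_def)

lemma h_abc_eq:
  "h_abc a b c (- u) (- v) q (-1) (-1) =
     jtheta (- u) (q powi a) * (1 / jtheta (-1) Q1 * A1) + jtheta (- v) (q powi c) * (1 / jtheta (-1) Q0 * A0)"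
  using appell_lerch_1 appell_lerch_0
  unfolding h_abc_def div_simps Q1_def Q0_def by simp

lemma J2_bar_eq: "J2_bar 0 (b^2 div a - c) q = jtheta (-1) Q1" "J2_bar 0 (b^2 div c - a) q = jtheta (-1) Q0"
  unfolding J2_bar_def div_simps Q1_def Q0_def by simp_all

text \<open>\<open>theta_sum\<close> solved for the Hecke-type series, dividing by the nonzero
  values j(-1;Q1) and j(-1;Q0).\<close>

theorem hecke_f_off_circles:
  assumes X: "\<And>k::int. norm (Q0 powi k * X0) \<noteq> 1" and Y: "\<And>k::int. norm (Q1 powi k * Y0) \<noteq> 1"
  shows "hecke_f a b c (- u) (- v) q = h_abc a b c (- u) (- v) q (-1) (-1)
    - 1 / (J2_bar 0 (b^2 div a - c) q * J2_bar 0 (b^2 div c - a) q) * theta_abc a b c (- u) (- v) q"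
  unfolding h_abc_eq J2_bar_eq theta_abc_eq theta_sum[OF X Y]
  using jtheta_minus_one_nz[OF Q1] jtheta_minus_one_nz[OF Q0] by (simp add: field_simps)

end

section \<open>From points off the critical circles to all generic points\<close>

lemma power_int_root_unique:
  fixes t r :: real
  assumes "t > 0" "n > (0::int)" "t powi n = r"
  shows "t = root (nat n) r"
  using assms by (simp add: power_int_nonneg_exp real_root_power_cancel flip: assms(3))

theorem theorem0p4:
  fixes a b c :: int and x y q :: complex
  assumes "0 < norm q" and "norm q < 1"
    and "a > 0" and "b > 0" and "c > 0"
    and "a * c < b^2"
    and "a dvd b" and "c dvd b"
    and "x \<noteq> 0" and "y \<noteq> 0"
    and "generic a b c x y q"
  shows "hecke_f a b c x y q =
    h_abc a b c x y q (-1) (-1)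
    - 1 / (J2_bar 0 (b^2 div a - c) q * J2_bar 0 (b^2 div c - a) q) * theta_abc a b c x y q"
proof -
  define \<alpha> where "\<alpha> = b div a"
  define \<gamma> where "\<gamma> = b div c"
  define D where "D = \<alpha> * \<gamma> - 1"
  have b: "b = a * \<alpha>" "b = c * \<gamma>" using assms by (simp_all add: \<alpha>_def \<gamma>_def)
  have pos: "\<alpha> > 0" "\<gamma> > 0"
    using assms b by (metis zero_less_mult_pos)+
  have "b^2 = (a * \<alpha>) * (c * \<gamma>)" using b by (simp add: power2_eq_square)
  hence "a * c * 1 < a * c * (\<alpha> * \<gamma>)" using assms(6) by (simp add: mult_ac)
  hence "1 < \<alpha> * \<gamma>" using assms(3,5) by (simp only: mult_less_cancel_left_pos mult_pos_pos)
  hence D: "D > 0" by (simp add: D_def)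
  have q: "q \<noteq> 0" using assms(1) by auto
  \<comment> \<open>Stated for every nonzero \<open>z\<close> because the locale is used at the
    approximating points as well as at \<open>x\<close>.\<close>
  have hset: "hecke_form a b c \<alpha> \<gamma> D q (- z) (- y)" if "z \<noteq> 0" for z
    using that assms pos b D q by (unfold_locales) (simp_all add: D_def)
  interpret hs: hecke_form a b c \<alpha> \<gamma> D q "- x" "- y" by (rule hset[OF assms(9)])

  define Q1 where "Q1 = q powi (c * D)"
  define Q0 where "Q0 = q powi (a * D)"
  define Y where "Y = (\<lambda>z. q powi (- (a * choose2 \<alpha>)) * (- z) powi (- \<alpha>) * (- y))"
  define X where "X = (\<lambda>z. q powi (- (c * choose2 \<gamma>)) * (- z) * (- y) powi (- \<gamma>))"
  define S where "S = (\<lambda>p w. \<Sum>\<^sub>\<infinity>r. (p::complex) powi choose2 r / (1 - p powi r * w))"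
  have Q: "hs.Q1 = Q1" "hs.Q0 = Q0" by (simp_all add: hs.Q1_def hs.Q0_def Q1_def Q0_def)
  note Q1 = hs.Q1[unfolded Q] and Q0 = hs.Q0[unfolded Q]
  have XY0: "Y z \<noteq> 0" "X z \<noteq> 0" if "z \<noteq> 0" for z
    using that q assms(10) by (simp_all add: X_def Y_def)
  have XY: "hs.Y0 = Y x" "hs.X0 = X x"
    by (simp_all add: hs.Y0_def hs.X0_def hs.mono_def X_def Y_def)
  have off: "hecke_f a b c z y q = h_abc a b c z y q (-1) (-1)
    - 1 / (J2_bar 0 (b^2 div a - c) q * J2_bar 0 (b^2 div c - a) q) * theta_abc a b c z y q"
    if z: "z \<noteq> 0" and XY_off: "\<And>k::int. norm (Q0 powi k * X z) \<noteq> 1" "\<And>k::int. norm (Q1 powi k * Y z) \<noteq> 1" for z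
  proof -
    interpret z: hecke_form a b c \<alpha> \<gamma> D q "- z" "- y" by (rule hset[OF z])
    have "z.Q1 = Q1" "z.Q0 = Q0" "z.Y0 = Y z" "z.X0 = X z"
      by (simp_all add: z.Q1_def z.Q0_def Q1_def Q0_def z.Y0_def z.X0_def z.mono_def X_def Y_def)
    thus ?thesis using z.hecke_f_off_circles XY_off by simp
  qed
  have h: "h_abc a b c z y q (-1) (-1) = jtheta z (q powi a) * (1 / jtheta (-1) Q1 * S Q1 (Y z)) +
      jtheta y (q powi c) * (1 / jtheta (-1) Q0 * S Q0 (X z))" if z: "z \<noteq> 0" for z
  proof -
    interpret z: hecke_form a b c \<alpha> \<gamma> D q "- z" "- y" by (rule hset[OF z])
    have "z.Q1 = Q1" "z.Q0 = Q0" "z.Y0 = Y z" "z.X0 = X z"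
      by (simp_all add: z.Q1_def z.Q0_def Q1_def Q0_def z.Y0_def z.X0_def z.mono_def X_def Y_def)
    thus ?thesis using z.h_abc_eq by (simp add: z.A1_def z.A0_def S_def)
  qed

  \<comment> \<open>The expansions need every \<open>|Q1^k Y|\<close> and \<open>|Q0^k X|\<close> to differ from 1. For \<open>x\<close> scaled by a positive
    real this excludes only countably many factors, so \<open>x\<close> is a limit of admissible points.\<close>
  define B where "B = range (\<lambda>k::int. root (nat \<alpha>) (norm (Q1 powi k * Y x))) \<union>
      range (\<lambda>k::int. inverse (norm (Q0 powi k * X x)))"
  have "countable B" by (simp add: B_def)
  have "\<exists>t. 1 < t \<and> t < 1 + 1 / real (Suc n) \<and> t \<notin> B" for n
  proof -
    have "uncountable ({1<..<1 + 1 / real (Suc n)} - B)"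
      using uncountable_minus_countable[OF _ \<open>countable B\<close>] uncountable_open_interval[of 1 "1 + 1 / real (Suc n)"]
      by simp
    hence "{1<..<1 + 1 / real (Suc n)} - B \<noteq> {}" by (metis countable_empty)
    thus ?thesis by auto
  qed
  then obtain t where t: "\<And>n. 1 < t n" "\<And>n. t n < 1 + 1 / real (Suc n)" "\<And>n. t n \<notin> B"
    by metis
  define z where "z = (\<lambda>n. of_real (t n) * x)"
  have t0: "t n > 0" for n using t(1)[of n] by simp
  have z0: "z n \<noteq> 0" for n using t0[of n] assms(9) by (simp add: z_def)
  have "t \<longlonglongrightarrow> 1"
  proof (rule tendsto_sandwich[of "\<lambda>_. 1" _ _ "\<lambda>n. 1 + 1 / real (Suc n)"])
    show "(\<lambda>n. 1 + 1 / real (Suc n)) \<longlonglongrightarrow> 1"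
      using tendsto_add[OF tendsto_const[of 1] LIMSEQ_inverse_real_of_nat] by (simp add: divide_inverse)
  qed (use t in \<open>auto intro!: always_eventually less_imp_le\<close>)
  hence "z \<longlonglongrightarrow> of_real 1 * x" unfolding z_def by (intro tendsto_intros)
  hence z: "z \<longlonglongrightarrow> x" by simp
  \<comment> \<open>\<open>X\<close> is homogeneous of degree 1 and \<open>Y\<close> of degree
    -\<alpha>, so after scaling by \<open>t n\<close> a modulus can be 1 only if \<open>t n\<close>
    is one of the values collected in \<open>B\<close>.\<close>
  have X_off: "norm (Q0 powi k * X (z n)) \<noteq> 1" for n k
  proof
    assume "norm (Q0 powi k * X (z n)) = 1"
    moreover have "norm (Q0 powi k * X (z n)) = t n * norm (Q0 powi k * X x)"
      using t0[of n] by (simp add: X_def z_def norm_mult)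
    ultimately have "t n = inverse (norm (Q0 powi k * X x))"
      using t0[of n] by (metis inverse_unique mult.commute)
    thus False using t(3)[of n] by (auto simp: B_def)
  qed
  have Y_off: "norm (Q1 powi k * Y (z n)) \<noteq> 1" for n k
  proof
    assume "norm (Q1 powi k * Y (z n)) = 1"
    moreover have "norm (Q1 powi k * Y (z n)) = norm (Q1 powi k * Y x) / t n powi \<alpha>"
    proof -
      have "- z n = of_real (t n) * (- x)" by (simp add: z_def)
      hence "norm ((- z n) powi (- \<alpha>)) = inverse (t n powi \<alpha>) * norm ((- x) powi (- \<alpha>))"
        using t0[of n] by (simp only: power_int_mult_distrib)
          (simp add: norm_mult norm_power_int power_int_minus norm_inverse)
      thus ?thesis by (simp add: Y_def norm_mult divide_inverse mult_ac)
    qed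
    ultimately have "t n powi \<alpha> = norm (Q1 powi k * Y x)"
      using t0[of n] by (simp add: field_simps)
    hence "t n = root (nat \<alpha>) (norm (Q1 powi k * Y x))"
      by (intro power_int_root_unique t0 pos)
    thus False using t(3)[of n] by (auto simp: B_def)
  qed

  note gen = assms(11)[unfolded generic_def appell_lerch_no_pole_def]
  \<comment> \<open>Genericity keeps \<open>Q1 * Y x\<close> away from all powers of
    \<open>Q1\<close>; a value Q1^k Y = 1 would make it Q1^(1-k).\<close>
  have Y_pole: "Q1 powi k * Y x \<noteq> 1" for k
  proof
    assume *: "Q1 powi k * Y x = 1"
    have "al_arg1 a b c x y q * - 1 = Q1 * Y x"
      using hs.al_arg1_eq by (simp add: Q XY)
    also have "\<dots> = Q1 powi (1 - k) * (Q1 powi k * Y x)"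
      using Q1 by (simp add: power_int_diff)
    finally have "al_arg1 a b c x y q * - 1 = (q powi (b^2 div a - c)) powi (1 - k)"
      using * by (simp only: hs.div_simps Q1_def) simp
    thus False using gen by blast
  qed
  have X_pole: "Q0 powi k * X x \<noteq> 1" for k
  proof
    assume *: "Q0 powi k * X x = 1"
    have "al_arg0 a b c x y q * - 1 = Q0 * X x"
      using hs.al_arg0_eq by (simp add: Q XY)
    also have "\<dots> = Q0 powi (1 - k) * (Q0 powi k * X x)"
      using Q0 by (simp add: power_int_diff)
    finally have "al_arg0 a b c x y q * - 1 = (q powi (b^2 div c - a)) powi (1 - k)"
      using * by (simp only: hs.div_simps Q0_def) simp
    thus False using gen by blast
  qed
  have lim_X: "(\<lambda>n. X (z n)) \<longlonglongrightarrow> X x" and lim_Y: "(\<lambda>n. Y (z n)) \<longlonglongrightarrow> Y x"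
    unfolding X_def Y_def using assms(9) by (auto intro!: tendsto_intros z)
  have qa: "q powi a \<noteq> 0" "norm (q powi a) < 1" using hs.q_powi[of a] assms by auto
  have lim_h: "(\<lambda>n. h_abc a b c (z n) y q (-1) (-1)) \<longlonglongrightarrow> h_abc a b c x y q (-1) (-1)"
    unfolding h[OF z0] h[OF assms(9)] S_def
    by (intro tendsto_add tendsto_mult tendsto_const tendsto_jtheta qa assms(9) z
        tendsto_appell_sum Q1 Q0 XY0 X_pole Y_pole lim_X lim_Y)
  have pq: "q powi (b^2 div a) \<noteq> 0" "norm (q powi (b^2 div a)) < 1"
    "q powi (b^2 div a * (b^2 div (a * c) - 1)) \<noteq> 0" "norm (q powi (b^2 div a * (b^2 div (a * c) - 1))) < 1"
    "q powi (b * (b^2 div (a * c) - 1)) \<noteq> 0" "norm (q powi (b * (b^2 div (a * c) - 1))) < 1"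
    using hs.q_powi assms(4) pos D unfolding hs.div_simps D_def[symmetric] by simp_all
  \<comment> \<open>The limit of each quotient exists because \<open>generic\<close> makes the
    denominators nonzero at \<open>x\<close>.\<close>
  have lim_theta: "(\<lambda>n. theta_abc a b c (z n) y q) \<longlonglongrightarrow> theta_abc a b c x y q"
    unfolding theta_abc_def theta_denom_e_def theta_denom_d_def
    by (intro tendsto_sum tendsto_mult tendsto_divide tendsto_const tendsto_jtheta pq tendsto_power_int tendsto_minus z)
       (use gen q assms(9,10) in \<open>auto simp: theta_denom_e_def theta_denom_d_def\<close>)
  have "(\<lambda>n. hecke_f a b c (z n) y q) \<longlonglongrightarrow> h_abc a b c x y q (-1) (-1)
    - 1 / (J2_bar 0 (b^2 div a - c) q * J2_bar 0 (b^2 div c - a) q) * theta_abc a b c x y q"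
    unfolding off[OF z0 X_off Y_off] by (intro tendsto_diff tendsto_mult tendsto_const lim_h lim_theta)
  moreover have "(\<lambda>n. hecke_f a b c (z n) y q) \<longlonglongrightarrow> hecke_f a b c x y q"
    by (rule tendsto_hecke_f) (use assms q z in auto)
  ultimately show ?thesis by (metis LIMSEQ_unique)
qed

end
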